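(* Let $x$ be a positive left-computable number. Then: (a) $\varsigma_x\in[1,2]$. (b) If $\varsigma_x\in[1,2[$ (i.e. $1\le\varsigma_x<2$), then $x$ is reordered computable. (c) If $x$ is regular, then $\varsigma_x=1$. (d) If $x$ is nearly computable, then $\varsigma_x=1$ or $\varsigma_x=2$. (e) If $x$ is Martin-Löf random, then $\varsigma_x=2$.
   Context: $\mathbb{N}=\{0,1,2,\dots\}$. A real number is left-computable if some computable strictly increasing sequence of rational numbers converges to it. A function $f\colon\mathbb{N}\to\mathbb{N}$ tends to infinity if for every $c$ there is $m$ with $f(n)>c$ for all $n\ge m$. For such $f$, $u_f(n) := |\{k\in\mathbb{N} \mid f(k)=n\}|$. A function $f\colon\mathbb{N}\to\mathbb{N}$ is a name for a real number $x$ if $\sum_{k=0}^\infty 2^{-f(k)} = x$ (then $f$ tends to infinity). A positive real is left-computable iff it has a computable name. The characteristic dyadic value of a left-computable number $x$ is $\varsigma_x := \inf\{\limsup_{n\to\infty}\sqrt[n]{u_f(n)} \mid f \text{ is a computable name for } x\}$. A convergent sequence $(x_n)_n$ with limit $x$ converges computably (to $x$) if there is a computable $s\colon\mathbb{N}\to\mathbb{N}$ with $|x-x_k|\le 2^{-n}$ for all $n$ and all $k\ge s(n)$; a series converges computably if the sequence of its partial sums $\left(\sum_{k=0}^{n-1}a_k\right)_n$ does (no computability of the terms is required). A real number is reordered computable if it has a computable name $f$ such that $\sum_{k=0}^\infty u_f(k)\cdot 2^{-k}$ converges computably. A real number in $[0,1]$ is strongly left-computable if it equals $\sum_{n\in A}2^{-(n+1)}$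 for some computably enumerable set $A\subseteq\mathbb{N}$. A real number is regular if it is a sum of finitely many strongly left-computable numbers. A sequence $(x_n)_n$ of reals is nearly computably convergent if it converges and, for every computable strictly increasing function $s\colon\mathbb{N}\to\mathbb{N}$, the sequence $(x_{s(n+1)}-x_{s(n)})_n$ converges computably to $0$. A real number is nearly computable if there exists a computable sequence of rational numbers which converges nearly computably to it. Martin-Löf randomness is the standard notion: a real is Martin-Löf random if there is no uniformly computably enumerable sequence $(U_n)_n$ of open sets (each a c.e. union of open rational intervals) with Lebesgue measure $\lambda(U_n)\le 2^{-n}$ for all $n$ and $x\in\bigcap_n U_n$. *)

theory Defs
  imports "HOL-Analysis.Analysis"
begin

section \<open>Computable functions on the natural numbers\<close>

text \<open>
  \<open>recursive_fun n f\<close>: the function \<open>f\<close> is a total recursive function of \<open>n\<close> arguments, the arguments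
  being passed as a list of length \<open>n\<close>; the values of \<open>f\<close> on lists of other lengths are irrelevant.
  This is the least class that contains the zero functions, the successor and the projections and
  is closed under composition, primitive recursion (on the first argument) and minimization of
  functions that have a zero for all parameters.
\<close>

inductive recursive_fun :: "nat \<Rightarrow> (nat list \<Rightarrow> nat) \<Rightarrow> bool" where
  Zero: "recursive_fun n (\<lambda>xs. 0)"
| Succ: "recursive_fun 1 (\<lambda>xs. Suc (hd xs))"
| Proj: "i < n \<Longrightarrow> recursive_fun n (\<lambda>xs. xs ! i)"
| Comp: "recursive_fun (length gs) f \<Longrightarrow> \<forall>g\<in>set gs. recursive_fun n g \<Longrightarrow>
    recursive_fun n (\<lambda>xs. f (map (\<lambda>g. g xs) gs))"
| PrimRec: "recursive_fun n f \<Longrightarrow> recursive_fun (Suc (Suc n)) g \<Longrightarrow>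
    recursive_fun (Suc n) (\<lambda>xs. rec_nat (f (tl xs)) (\<lambda>k r. g (k # r # tl xs)) (hd xs))"
| Minimize: "recursive_fun (Suc n) f \<Longrightarrow> \<forall>xs. length xs = n \<longrightarrow> (\<exists>k. f (k # xs) = 0) \<Longrightarrow>
    recursive_fun n (\<lambda>xs. LEAST k. f (k # xs) = 0)"

definition computable :: "(nat \<Rightarrow> nat) \<Rightarrow> bool" where
  "computable f \<longleftrightarrow> (\<exists>g. recursive_fun 1 g \<and> (\<forall>k. g [k] = f k))"

definition computable2 :: "(nat \<Rightarrow> nat \<Rightarrow> nat) \<Rightarrow> bool" where
  "computable2 f \<longleftrightarrow> (\<exists>g. recursive_fun 2 g \<and> (\<forall>n k. g [n, k] = f n k))"

definition ce_set :: "nat set \<Rightarrow> bool" where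
  "ce_set A \<longleftrightarrow> A = {} \<or> (\<exists>f. computable f \<and> A = range f)"

definition computable_rat_seq :: "(nat \<Rightarrow> rat) \<Rightarrow> bool" where
  "computable_rat_seq q \<longleftrightarrow> (\<exists>a b c. computable a \<and> computable b \<and> computable c \<and>
     (\<forall>k. q k = (of_nat (a k) - of_nat (b k)) / of_nat (Suc (c k))))"

definition computable_rat_seq2 :: "(nat \<Rightarrow> nat \<Rightarrow> rat) \<Rightarrow> bool" where
  "computable_rat_seq2 q \<longleftrightarrow> (\<exists>a b c. computable2 a \<and> computable2 b \<and> computable2 c \<and>
     (\<forall>n k. q n k = (of_nat (a n k) - of_nat (b n k)) / of_nat (Suc (c n k))))"


section \<open>Left-computable numbers, names and the characteristic dyadic value\<close>

definition left_computable :: "real \<Rightarrow> bool" where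
  "left_computable x \<longleftrightarrow>
     (\<exists>q. computable_rat_seq q \<and> strict_mono q \<and> (\<lambda>n. real_of_rat (q n)) \<longlonglongrightarrow> x)"

definition is_name :: "(nat \<Rightarrow> nat) \<Rightarrow> real \<Rightarrow> bool" where
  "is_name f x \<longleftrightarrow> (\<lambda>k. (1 / 2) ^ f k) sums x"

text \<open>
  Only meaningful if \<open>f\<close> tends to infinity, as every name does: otherwise a fibre may be infinite,
  with \<open>card\<close> equal to 0.
\<close>

definition fibre_count :: "(nat \<Rightarrow> nat) \<Rightarrow> nat \<Rightarrow> nat" where
  "fibre_count f n = card {k. f k = n}"

text \<open>
  The limes superior and the infimum are taken in the extended reals, where they always exist.
\<close>

definition char_dyadic_value :: "real \<Rightarrow> ereal" where
  "char_dyadic_value x =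
     Inf {limsup (\<lambda>n. ereal (root n (real (fibre_count f n)))) | f. computable f \<and> is_name f x}"


section \<open>Computable convergence and reordered computable numbers\<close>

definition converges_computably_to :: "(nat \<Rightarrow> real) \<Rightarrow> real \<Rightarrow> bool" where
  "converges_computably_to X x \<longleftrightarrow> X \<longlonglongrightarrow> x \<and>
     (\<exists>s. computable s \<and> (\<forall>n. \<forall>k\<ge>s n. \<bar>x - X k\<bar> \<le> (1 / 2) ^ n))"

definition series_converges_computably :: "(nat \<Rightarrow> real) \<Rightarrow> bool" where
  "series_converges_computably a \<longleftrightarrow> (\<exists>x. converges_computably_to (\<lambda>n. \<Sum>k<n. a k) x)"

definition reordered_computable :: "real \<Rightarrow> bool" where
  "reordered_computable x \<longleftrightarrow> (\<exists>f. computable f \<and> is_name f x \<and>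
     series_converges_computably (\<lambda>k. real (fibre_count f k) * (1 / 2) ^ k))"


section \<open>Regular, nearly computable and random numbers\<close>

definition strongly_left_computable :: "real \<Rightarrow> bool" where
  "strongly_left_computable x \<longleftrightarrow> x \<in> {0..1} \<and>
     (\<exists>A. ce_set A \<and> ((\<lambda>n. (1 / 2) ^ (n + 1)) has_sum x) A)"

definition regular_real :: "real \<Rightarrow> bool" where
  "regular_real x \<longleftrightarrow> (\<exists>ys. (\<forall>y\<in>set ys. strongly_left_computable y) \<and> x = sum_list ys)"

definition nearly_computably_convergent :: "(nat \<Rightarrow> real) \<Rightarrow> bool" where
  "nearly_computably_convergent X \<longleftrightarrow> convergent X \<and>
     (\<forall>s. computable s \<and> strict_mono s \<longrightarrow>
        converges_computably_to (\<lambda>n. X (s (n + 1)) - X (s n)) 0)"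

definition nearly_computable :: "real \<Rightarrow> bool" where
  "nearly_computable x \<longleftrightarrow> (\<exists>q. computable_rat_seq q \<and>
     nearly_computably_convergent (\<lambda>n. real_of_rat (q n)) \<and> (\<lambda>n. real_of_rat (q n)) \<longlonglongrightarrow> x)"

text \<open>
  The intervals with \<open>b n k \<le> a n k\<close> are empty, so the enumerations need not produce a proper
  interval at every stage, and empty sets are covered.
\<close>

definition uniformly_ce_open :: "(nat \<Rightarrow> real set) \<Rightarrow> bool" where
  "uniformly_ce_open U \<longleftrightarrow> (\<exists>a b. computable_rat_seq2 a \<and> computable_rat_seq2 b \<and>
     (\<forall>n. U n = (\<Union>k. {real_of_rat (a n k)<..<real_of_rat (b n k)})))"

definition martin_loef_random :: "real \<Rightarrow> bool" where
  "martin_loef_random x \<longleftrightarrow> \<not> (\<exists>U. uniformly_ce_open U \<and>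
     (\<forall>n. emeasure lborel (U n) \<le> ennreal ((1 / 2) ^ n)) \<and> x \<in> (\<Inter>n. U n))"

end

theory Submission
  imports Defs
begin

text \<open>
  Computability is handled through numberings. A numbered type carries a surjection \<open>num\<close> from the
  natural numbers, and a map is \<open>effective\<close> if it is tracked by a computable function on codes.
  Effective maps into the rationals are closed under arithmetic, comparison, primitive recursion
  and unbounded search, so every algorithm below is written as an ordinary term over the rationals.

  The bounds \<open>1\<close> and \<open>2\<close> need only two remarks. A name takes arbitrarily large values, so infinitely
  many of its fibres are nonempty; and the fibre over \<open>n\<close> contributes
  \<open>fibre_count f n * (1/2) ^ n \<le> x\<close> to the sum. That computable names exist at all is shown by the
  greedy name: from an increasing rational approximation \<open>q\<close> of \<open>x\<close> it emits in step \<open>n\<close> the largest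
  power of \<open>1/2\<close> that keeps the sum of the emitted powers below \<open>q n\<close>. If \<open>q\<close> converges fast, the
  greedy name uses each exponent \<open>m\<close> at most \<open>m + 4\<close> times (\<open>fibre_count_greedy_name_le\<close>), which
  gives the value \<open>1\<close> to every positive computable real.

  A value below \<open>2\<close> yields a computable name with
  \<open>fibre_count f n * (1/2) ^ n \<le> \<rho> ^ n\<close> for some \<open>\<rho> < 1\<close> and all large \<open>n\<close>
  (\<open>name_with_geometric_fibres\<close>), and this name decides the remaining claims. The series sorted by
  exponent is dominated by a geometric series, so it converges computably.

  If \<open>x\<close> is moreover nearly computable by a sequence \<open>q\<close>, choose a computable subsequence along
  which \<open>q\<close> is very close to the partial sums of the name. Its increments tend to \<open>0\<close> computably,
  and they bound every term of the name in the corresponding block; so it is computable from which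
  index on all exponents exceed a given \<open>N\<close> (\<open>name_escape_modulus\<close>). All later terms together have at
  most the weight of the fibres above \<open>N\<close>, which is geometrically small. So \<open>x\<close> is computable and its
  value is \<open>1\<close>.

  If \<open>x\<close> had such a name and were random, compare the partial sums \<open>X n\<close> of the name with the partial
  sums \<open>Y n\<close> of the terms \<open>f k * (1/2) ^ f k\<close>. The second series still converges because the fibres
  are geometrically small, but its tails exceed every multiple of the tails of the first. By an
  argument of Kucera and Slaman, an increasing approximation of a random real cannot be that much
  faster than another increasing computable sequence: otherwise intervals with left endpoints
  among the \<open>X t\<close>, whose lengths are charged to the increase of \<open>Y\<close>, form a test that captures the
  limit (\<open>not_martin_loef_random_if_slower\<close>).

  For a regular number the sum over all the c.e. sets is a family of powers of \<open>1/2\<close> in which every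
  power occurs boundedly often. It is a name if the family is infinite, and a rational number
  otherwise.
\<close>

section \<open>Closure properties of recursive functions\<close>

text \<open>
  The values of a recursive function on lists of unintended length depend on how it was built.
  Ignoring them makes the notion closed under rewriting on lists of length \<open>n\<close>.
\<close>

definition list_computable :: "nat \<Rightarrow> (nat list \<Rightarrow> nat) \<Rightarrow> bool" where
  "list_computable n F \<longleftrightarrow> (\<exists>g. recursive_fun n g \<and> (\<forall>xs. length xs = n \<longrightarrow> g xs = F xs))"

lemma list_computable_comp:
  assumes "list_computable (length Gs) F" and "\<forall>G\<in>set Gs. list_computable n G"
  shows "list_computable n (\<lambda>xs. F (map (\<lambda>G. G xs) Gs))"
proof -
  obtain f where f: "recursive_fun (length Gs) f" "\<And>xs. length xs = length Gs \<Longrightarrow> f xs = F xs"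
    using assms(1) by (auto simp: list_computable_def)
  obtain c where c: "\<And>G. G \<in> set Gs \<Longrightarrow> recursive_fun n (c G) \<and> (\<forall>xs. length xs = n \<longrightarrow> c G xs = G xs)"
    using assms(2) unfolding list_computable_def by metis
  have "recursive_fun n (\<lambda>xs. f (map (\<lambda>g. g xs) (map c Gs)))"
    using f(1) c by (intro recursive_fun.Comp) auto
  moreover have "f (map (\<lambda>g. g xs) (map c Gs)) = F (map (\<lambda>G. G xs) Gs)" if "length xs = n" for xs
  proof -
    have "map (\<lambda>g. g xs) (map c Gs) = map (\<lambda>G. G xs) Gs" using c that by auto
    then show ?thesis using f(2) by (metis length_map)
  qed
  ultimately show ?thesis unfolding list_computable_def by blast
qed

lemma list_computable_cong:
  "list_computable n F \<Longrightarrow> (\<And>xs. length xs = n \<Longrightarrow> F xs = G xs) \<Longrightarrow> list_computable n G"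
  unfolding list_computable_def by metis

lemma list_computable_nth: "i < n \<Longrightarrow> list_computable n (\<lambda>xs. xs ! i)"
  unfolding list_computable_def using recursive_fun.Proj by blast

lemma list_computable_zero: "list_computable n (\<lambda>xs. 0)"
  unfolding list_computable_def using recursive_fun.Zero by blast

lemma list_computable_Suc:
  assumes "list_computable n F"
  shows "list_computable n (\<lambda>xs. Suc (F xs))"
proof -
  have "list_computable (length [F]) (\<lambda>xs. Suc (hd xs))"
    unfolding list_computable_def using recursive_fun.Succ by auto
  from list_computable_comp[OF this, of n] assms show ?thesis by simp
qed

text \<open>
  The step function of a recursion receives a counter and an accumulator in front of the
  parameters; this shifts a function of the parameters past them.
\<close>

lemma list_computable_drop:
  assumes "list_computable n F"
  shows "list_computable (m + n) (\<lambda>xs. F (drop m xs))"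
proof -
  let ?Gs = "map (\<lambda>i xs. xs ! (m + i)) [0..<n]"
  have "list_computable (m + n) (\<lambda>xs. F (map (\<lambda>G. G xs) ?Gs))"
    by (rule list_computable_comp) (use assms in \<open>auto intro: list_computable_nth\<close>)
  then show ?thesis
  proof (rule list_computable_cong)
    fix xs :: "nat list" assume "length xs = m + n"
    then have "map (\<lambda>G. G xs) ?Gs = drop m xs" by (auto intro!: nth_equalityI)
    then show "F (map (\<lambda>G. G xs) ?Gs) = F (drop m xs)" by simp
  qed
qed

text \<open>
  The bound of the recursion may be any computable function of the parameters: it is put in front
  of the unchanged parameters by composition with projections.
\<close>

lemma list_computable_rec:
  assumes "list_computable n A" and "list_computable (Suc (Suc n)) B" and "list_computable n N"
  shows "list_computable n (\<lambda>xs. rec_nat (A xs) (\<lambda>k r. B (k # r # xs)) (N xs))"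
proof -
  obtain a where a: "recursive_fun n a" "\<And>xs. length xs = n \<Longrightarrow> a xs = A xs"
    using assms(1) by (auto simp: list_computable_def)
  obtain b where b: "recursive_fun (Suc (Suc n)) b" "\<And>xs. length xs = Suc (Suc n) \<Longrightarrow> b xs = B xs"
    using assms(2) by (auto simp: list_computable_def)
  let ?R = "\<lambda>xs. rec_nat (a (tl xs)) (\<lambda>k r. b (k # r # tl xs)) (hd xs)"
  let ?Gs = "N # map (\<lambda>i xs. xs ! i) [0..<n]"
  have "list_computable (length ?Gs) ?R"
    unfolding list_computable_def using recursive_fun.PrimRec[OF a(1) b(1)] by auto
  then have "list_computable n (\<lambda>xs. ?R (map (\<lambda>G. G xs) ?Gs))"
    by (rule list_computable_comp) (use assms in \<open>auto intro: list_computable_nth\<close>)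
  then show ?thesis
  proof (rule list_computable_cong)
    fix xs :: "nat list" assume xs: "length xs = n"
    then have "map (\<lambda>G. G xs) ?Gs = N xs # xs" by (auto intro!: nth_equalityI)
    then show "?R (map (\<lambda>G. G xs) ?Gs) = rec_nat (A xs) (\<lambda>k r. B (k # r # xs)) (N xs)"
      using xs a(2) b(2) by simp
  qed
qed

lemma list_computable_Least:
  assumes "list_computable (Suc n) P" and ex: "\<And>xs. length xs = n \<Longrightarrow> \<exists>k. P (k # xs) = 0"
  shows "list_computable n (\<lambda>xs. LEAST k. P (k # xs) = 0)"
proof -
  obtain p where p: "recursive_fun (Suc n) p" "\<And>xs. length xs = Suc n \<Longrightarrow> p xs = P xs"
    using assms(1) by (auto simp: list_computable_def)
  have "recursive_fun n (\<lambda>xs. LEAST k. p (k # xs) = 0)"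
    using p ex by (intro recursive_fun.Minimize) auto
  moreover have "(LEAST k. p (k # xs) = 0) = (LEAST k. P (k # xs) = 0)" if "length xs = n" for xs
    using p(2) that by simp
  ultimately show ?thesis unfolding list_computable_def by blast
qed

lemma list_computable_add:
  assumes "list_computable n F" and "list_computable n G"
  shows "list_computable n (\<lambda>xs. F xs + G xs)"
proof -
  have "list_computable (Suc (Suc n)) (\<lambda>ys. Suc (ys ! 1))"
    by (intro list_computable_Suc list_computable_nth) simp
  from list_computable_rec[OF assms(1) this assms(2)]
  have "list_computable n (\<lambda>xs. rec_nat (F xs) (\<lambda>k. Suc) (G xs))" by simp
  moreover have "rec_nat a (\<lambda>k. Suc) m = a + m" for a m :: nat by (induction m) auto
  ultimately show ?thesis by simp
qed

lemma list_computable_diff: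
  assumes "list_computable n F" and "list_computable n G"
  shows "list_computable n (\<lambda>xs. F xs - G xs)"
proof -
  have pred: "list_computable n (\<lambda>xs. H xs - 1)" if "list_computable n H" for n H
  proof -
    have "list_computable (Suc (Suc n)) (\<lambda>ys. ys ! 0)" by (intro list_computable_nth) simp
    from list_computable_rec[OF list_computable_zero this that]
    have "list_computable n (\<lambda>xs. rec_nat 0 (\<lambda>k r. k) (H xs))" by simp
    moreover have "rec_nat 0 (\<lambda>k r. k) m = m - 1" for m :: nat by (cases m) auto
    ultimately show ?thesis by simp
  qed
  have "list_computable (Suc (Suc n)) (\<lambda>ys. ys ! 1 - 1)"
    by (intro pred list_computable_nth) simp
  from list_computable_rec[OF assms(1) this assms(2)]
  have "list_computable n (\<lambda>xs. rec_nat (F xs) (\<lambda>k r. r - 1) (G xs))" by simp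
  moreover have "rec_nat a (\<lambda>k r. r - 1) m = a - m" for a m :: nat by (induction m) auto
  ultimately show ?thesis by simp
qed

lemma list_computable_mult:
  assumes "list_computable n F" and "list_computable n G"
  shows "list_computable n (\<lambda>xs. F xs * G xs)"
proof -
  have "list_computable (Suc (Suc n)) (\<lambda>ys. ys ! 1 + F (drop 2 ys))"
    using list_computable_drop[OF assms(1), of 2]
    by (intro list_computable_add list_computable_nth) simp_all
  from list_computable_rec[OF list_computable_zero this assms(2)]
  have "list_computable n (\<lambda>xs. rec_nat 0 (\<lambda>k r. r + F xs) (G xs))" by simp
  moreover have "rec_nat 0 (\<lambda>k r. r + a) m = a * m" for a m :: nat by (induction m) auto
  ultimately show ?thesis by simp
qed

lemma list_computable_triangle:
  assumes "list_computable n F"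
  shows "list_computable n (\<lambda>xs. triangle (F xs))"
proof -
  have "list_computable (Suc (Suc n)) (\<lambda>ys. ys ! 1 + Suc (ys ! 0))"
    by (intro list_computable_add list_computable_Suc list_computable_nth) simp_all
  from list_computable_rec[OF list_computable_zero this assms]
  have "list_computable n (\<lambda>xs. rec_nat 0 (\<lambda>k r. r + Suc k) (F xs))" by simp
  moreover have "rec_nat 0 (\<lambda>k r. r + Suc k) m = triangle m" for m by (induction m) auto
  ultimately show ?thesis by simp
qed

lemma list_computable_pair:
  assumes "list_computable n F" and "list_computable n G"
  shows "list_computable n (\<lambda>xs. prod_encode (F xs, G xs))"
  unfolding prod_encode_def prod.case
  by (intro list_computable_add list_computable_triangle assms)

lemma computable_iff_list: "computable f \<longleftrightarrow> list_computable 1 (\<lambda>xs. f (xs ! 0))"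
proof -
  have "(\<forall>xs. length xs = 1 \<longrightarrow> g xs = f (xs ! 0)) \<longleftrightarrow> (\<forall>k. g [k] = f k)" (is "?L \<longleftrightarrow> ?R") for g
  proof
    assume ?L
    then have "length [k] = 1 \<longrightarrow> g [k] = f ([k] ! 0)" for k by blast
    then show ?R by simp
  next
    assume ?R
    then show ?L by (auto simp: length_Suc_conv)
  qed
  then show ?thesis unfolding computable_def list_computable_def by blast
qed

lemma computable2_iff_list: "computable2 f \<longleftrightarrow> list_computable 2 (\<lambda>xs. f (xs ! 0) (xs ! 1))"
proof -
  have "(\<forall>xs. length xs = 2 \<longrightarrow> g xs = f (xs ! 0) (xs ! 1)) \<longleftrightarrow> (\<forall>n k. g [n, k] = f n k)"
    (is "?L \<longleftrightarrow> ?R") for g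
  proof
    assume ?L
    then have "length [n, k] = 2 \<longrightarrow> g [n, k] = f ([n, k] ! 0) ([n, k] ! 1)" for n k by blast
    then show ?R by simp
  next
    assume ?R
    then show ?L by (auto simp: length_Suc_conv numeral_2_eq_2)
  qed
  then show ?thesis unfolding computable2_def list_computable_def by blast
qed

lemma list_computable_apply:
  assumes "computable f" and "list_computable n F"
  shows "list_computable n (\<lambda>xs. f (F xs))"
proof -
  have "list_computable (length [F]) (\<lambda>ys. f (ys ! 0))"
    using assms(1) by (simp add: computable_iff_list)
  from list_computable_comp[OF this, of n] assms(2) show ?thesis by simp
qed

lemma computable_rec:
  assumes "computable a" and "computable b" and "computable c"
  shows "computable (\<lambda>z. rec_nat (a z) (\<lambda>k r. b (prod_encode (z, prod_encode (k, r)))) (c z))"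
proof -
  have "list_computable 3 (\<lambda>ys. b (prod_encode (ys ! 2, prod_encode (ys ! 0, ys ! 1))))"
    by (intro list_computable_apply[OF assms(2)] list_computable_pair list_computable_nth) simp_all
  then have "list_computable (Suc (Suc 1)) (\<lambda>ys. b (prod_encode (ys ! 2, prod_encode (ys ! 0, ys ! 1))))"
    by (simp add: numeral_3_eq_3)
  from list_computable_rec[OF _ this, of "\<lambda>xs. a (xs ! 0)" "\<lambda>xs. c (xs ! 0)"]
  show ?thesis using assms by (simp add: computable_iff_list numeral_2_eq_2)
qed

lemma computable_Least:
  assumes "computable p" and "\<And>z. \<exists>k. p (prod_encode (z, k)) = 0"
  shows "computable (\<lambda>z. LEAST k. p (prod_encode (z, k)) = 0)"
proof -
  have "list_computable (Suc 1) (\<lambda>ys. p (prod_encode (ys ! 1, ys ! 0)))"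
    by (intro list_computable_apply[OF assms(1)] list_computable_pair list_computable_nth) simp_all
  from list_computable_Least[OF this] assms(2) show ?thesis by (simp add: computable_iff_list)
qed

lemma computable_comp: "computable f \<Longrightarrow> computable g \<Longrightarrow> computable (\<lambda>z. f (g z))"
  unfolding computable_iff_list[of g] computable_iff_list[of "\<lambda>z. f (g z)"]
  by (rule list_computable_apply)

lemma computable_ident: "computable (\<lambda>z. z)"
  by (simp add: computable_iff_list list_computable_nth)

lemma computable_const: "computable (\<lambda>z. c)"
  unfolding computable_iff_list
  by (induction c) (auto intro: list_computable_zero list_computable_Suc)

lemma computable_arith:
  assumes "computable f" and "computable g"
  shows "computable (\<lambda>z. f z + g z)" and "computable (\<lambda>z. f z - g z)"
    and "computable (\<lambda>z. f z * g z)" and "computable (\<lambda>z. prod_encode (f z, g z))"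
  using assms unfolding computable_iff_list
  by (simp_all add: list_computable_add list_computable_diff list_computable_mult list_computable_pair)

lemma computable_Suc: "computable f \<Longrightarrow> computable (\<lambda>z. Suc (f z))"
  by (simp add: computable_iff_list list_computable_Suc)

text \<open>
  Pairs are enumerated along the diagonals \<open>m + n = k\<close>, the \<open>k\<close>-th one starting at \<open>triangle k\<close>.
  Decoding therefore amounts to a search for the diagonal of \<open>z\<close>.
\<close>

lemma prod_decode_eq_Least:
  defines "K \<equiv> \<lambda>z. LEAST k. Suc z - triangle (Suc k) = 0"
  shows "fst (prod_decode z) = z - triangle (K z)"
    and "snd (prod_decode z) = K z - (z - triangle (K z))"
proof -
  obtain m n where z: "z = prod_encode (m, n)" by (metis prod_decode_inverse surj_pair)
  have mono: "triangle i \<le> triangle j" if "i \<le> j" for i j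
    using that by (induction j rule: dec_induct) auto
  have "K z = m + n" unfolding K_def
  proof (rule Least_equality)
    show "Suc z - triangle (Suc (m + n)) = 0" by (simp add: z prod_encode_def)
    show "m + n \<le> k" if "Suc z - triangle (Suc k) = 0" for k
      using that mono[of "Suc k" "m + n"] by (fastforce simp: z prod_encode_def)
  qed
  then show "fst (prod_decode z) = z - triangle (K z)"
    and "snd (prod_decode z) = K z - (z - triangle (K z))"
    by (simp_all add: z) (simp_all add: prod_encode_def)
qed

lemma computable_prod_decode:
  "computable (\<lambda>z. fst (prod_decode z))" "computable (\<lambda>z. snd (prod_decode z))"
proof -
  let ?K = "\<lambda>z. LEAST k. Suc z - triangle (Suc k) = 0"
  have "list_computable (Suc 1) (\<lambda>ys. Suc (ys ! 1) - triangle (Suc (ys ! 0)))"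
    by (intro list_computable_diff list_computable_triangle list_computable_Suc
        list_computable_nth) simp_all
  moreover have "\<exists>k. Suc z - triangle (Suc k) = 0" for z
    by (intro exI[of _ z]) simp
  ultimately have K: "computable ?K"
    using list_computable_Least[of 1 "\<lambda>ys. Suc (ys ! 1) - triangle (Suc (ys ! 0))"]
    by (simp add: computable_iff_list)
  have tri: "computable triangle"
    by (simp add: computable_iff_list list_computable_triangle list_computable_nth)
  show "computable (\<lambda>z. fst (prod_decode z))" "computable (\<lambda>z. snd (prod_decode z))"
    unfolding prod_decode_eq_Least
    by (intro computable_arith computable_comp[OF tri] K computable_ident)+
qed

section \<open>Effective maps between numbered types\<close>

text \<open>
  Codes need not be unique. This allows unreduced fractions as codes of rationals, so that
  arithmetic on codes is polynomial; surjectivity is what makes constant maps effective.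
\<close>

class numbered =
  fixes num :: "nat \<Rightarrow> 'a"
  assumes num_surj: "\<exists>n. num n = a"

definition effective :: "('a::numbered \<Rightarrow> 'b::numbered) \<Rightarrow> bool" where
  "effective F \<longleftrightarrow> (\<exists>f. computable f \<and> (\<forall>n. F (num n) = num (f n)))"

instantiation nat :: numbered
begin
definition num_nat :: "nat \<Rightarrow> nat" where "num_nat n = n"
instance by standard (simp add: num_nat_def)
end

text \<open>Truth is coded by 0 because minimization searches for a zero.\<close>

instantiation bool :: numbered
begin
definition num_bool :: "nat \<Rightarrow> bool" where "num_bool n \<longleftrightarrow> n = 0"
instance
proof
  fix a show "\<exists>n. num n = (a :: bool)"
    by (rule exI[of _ "if a then 0 else 1"]) (simp add: num_bool_def)
qed
end

instantiation prod :: (numbered, numbered) numbered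
begin
definition num_prod :: "nat \<Rightarrow> 'a \<times> 'b" where
  "num_prod n = (num (fst (prod_decode n)), num (snd (prod_decode n)))"
instance
proof
  fix p :: "'a \<times> 'b"
  obtain i j where "num i = fst p" "num j = snd p" using num_surj by metis
  then show "\<exists>n. num n = p"
    by (intro exI[of _ "prod_encode (i, j)"]) (simp add: num_prod_def)
qed
end

definition rat_of_triple :: "nat \<times> nat \<times> nat \<Rightarrow> rat" where
  "rat_of_triple t = (of_nat (fst t) - of_nat (fst (snd t))) / of_nat (Suc (snd (snd t)))"

instantiation rat :: numbered
begin
definition num_rat :: "nat \<Rightarrow> rat" where "num_rat n = rat_of_triple (num n)"
instance
proof
  fix q :: rat
  obtain a b where q: "q = of_int a / of_int b" "b > 0"
    by (metis Fract_of_int_quotient Rat_cases)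
  have "q = rat_of_triple (nat a, nat (- a), nat (b - 1))"
    using q by (cases "a \<ge> 0") (auto simp: rat_of_triple_def of_nat_nat)
  then show "\<exists>n. num n = q"
    unfolding num_rat_def by (metis num_surj)
qed
end

lemma effective_nat_iff: "effective f \<longleftrightarrow> computable f" for f :: "nat \<Rightarrow> nat"
proof -
  have "computable f" if "computable g" "\<And>n. f n = g n" for g
    using that by (metis ext)
  then show ?thesis by (auto simp: effective_def num_nat_def)
qed

named_theorems effective_intros

text \<open>
  The rules collected here decompose a term syntactically. Composition with a given effective map is
  not among them: as a higher-order pattern it would apply to every goal.
\<close>

lemma effective_comp:
  assumes "effective F" and "effective G"
  shows "effective (\<lambda>x. F (G x))"
  using assms computable_comp unfolding effective_def by metis

lemma effective_ident [effective_intros]: "effective (\<lambda>x. x)"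
  unfolding effective_def using computable_ident by metis

lemma effective_const [effective_intros]: "effective (\<lambda>x. c)"
  unfolding effective_def using computable_const num_surj by metis

lemma effective_fst [effective_intros]:
  assumes "effective F"
  shows "effective (\<lambda>x. fst (F x))"
proof (rule effective_comp[OF _ assms])
  show "effective (fst :: 'b \<times> 'c \<Rightarrow> _)"
    unfolding effective_def num_prod_def
    by (intro exI[of _ "\<lambda>z. fst (prod_decode z)"] conjI computable_prod_decode) simp
qed

lemma effective_snd [effective_intros]:
  assumes "effective F"
  shows "effective (\<lambda>x. snd (F x))"
proof (rule effective_comp[OF _ assms])
  show "effective (snd :: 'b \<times> 'c \<Rightarrow> _)"
    unfolding effective_def num_prod_def
    by (intro exI[of _ "\<lambda>z. snd (prod_decode z)"] conjI computable_prod_decode) simp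
qed

lemma effective_Pair [effective_intros]:
  assumes "effective F" and "effective G"
  shows "effective (\<lambda>x. (F x, G x))"
proof -
  obtain f g where "computable f" "\<And>n. F (num n) = num (f n)" "computable g" "\<And>n. G (num n) = num (g n)"
    using assms unfolding effective_def by metis
  then show ?thesis unfolding effective_def num_prod_def
    by (intro exI[of _ "\<lambda>n. prod_encode (f n, g n)"]) (auto intro: computable_arith)
qed

lemma effective_rec [effective_intros]:
  fixes A :: "'a::numbered \<Rightarrow> 'b::numbered"
  assumes "effective A" and "effective (\<lambda>p. B (fst p) (fst (snd p)) (snd (snd p)))" and "effective N"
  shows "effective (\<lambda>x. rec_nat (A x) (B x) (N x))"
proof -
  obtain a where a: "computable a" "\<And>n. A (num n) = num (a n)"
    using assms(1) unfolding effective_def by metis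
  obtain b where b: "computable b"
      "\<And>n. (\<lambda>p. B (fst p) (fst (snd p)) (snd (snd p))) (num n) = num (b n)"
    using assms(2) unfolding effective_def by blast
  obtain c where c: "computable c" "\<And>n. N (num n) = c n"
    using assms(3) unfolding effective_def num_nat_def by metis
  have B: "B (num z) k (num r) = num (b (prod_encode (z, prod_encode (k, r))))" for z k r
    using b(2)[of "prod_encode (z, prod_encode (k, r))"] by (simp add: num_prod_def num_nat_def)
  have "rec_nat (A (num z)) (B (num z)) m =
      num (rec_nat (a z) (\<lambda>k r. b (prod_encode (z, prod_encode (k, r)))) m)" for z m
    by (induction m) (simp_all add: a B)
  then show ?thesis unfolding effective_def using computable_rec[OF a(1) b(1) c(1)] c(2) by auto
qed

text \<open>
  The search must succeed for every argument, because minimization is applied to total functions and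
  yields a total one.
\<close>

lemma effective_Least:
  assumes "effective (\<lambda>p. P (fst p) (snd p))" and "\<And>x. \<exists>k. P x k"
  shows "effective (\<lambda>x. LEAST k::nat. P x k)"
proof -
  obtain p where p: "computable p" "\<And>n. (\<lambda>p. P (fst p) (snd p)) (num n) = (p n = 0)"
    using assms(1) unfolding effective_def num_bool_def by blast
  have P: "P (num z) k \<longleftrightarrow> p (prod_encode (z, k)) = 0" for z k
    using p(2)[of "prod_encode (z, k)"] by (simp add: num_prod_def num_nat_def)
  then have "\<exists>k. p (prod_encode (z, k)) = 0" for z using assms(2) by blast
  from computable_Least[OF p(1) this] show ?thesis
    unfolding effective_def num_nat_def P by blast
qed

lemma effective_nat_op:
  fixes F G :: "'a::numbered \<Rightarrow> nat"
  assumes "effective F" and "effective G"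
    and "\<And>f g. computable f \<Longrightarrow> computable g \<Longrightarrow> computable (\<lambda>n. h (f n) (g n))"
    and "\<And>m n. H m n = num (h m n)"
  shows "effective (\<lambda>x. H (F x) (G x))"
  using assms unfolding effective_def num_nat_def by metis

lemma effective_nat_arith [effective_intros]:
  fixes F G :: "'a::numbered \<Rightarrow> nat"
  assumes "effective F" and "effective G"
  shows "effective (\<lambda>x. F x + G x)" and "effective (\<lambda>x. F x - G x)"
    and "effective (\<lambda>x. F x * G x)" and "effective (\<lambda>x. F x \<le> G x)"
    and "effective (\<lambda>x. F x < G x)" and "effective (\<lambda>x. F x = G x)"
proof -
  show "effective (\<lambda>x. F x + G x)"
    by (rule effective_nat_op[OF assms, of "(+)"]) (auto intro: computable_arith simp: num_nat_def)
  show "effective (\<lambda>x. F x - G x)"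
    by (rule effective_nat_op[OF assms, of "(-)"]) (auto intro: computable_arith simp: num_nat_def)
  show "effective (\<lambda>x. F x * G x)"
    by (rule effective_nat_op[OF assms, of "(*)"]) (auto intro: computable_arith simp: num_nat_def)
  show "effective (\<lambda>x. F x \<le> G x)"
    by (rule effective_nat_op[OF assms, of "(-)"]) (auto intro: computable_arith simp: num_bool_def)
  show "effective (\<lambda>x. F x < G x)"
    by (rule effective_nat_op[OF assms, of "\<lambda>m n. Suc m - n"])
      (auto intro: computable_arith computable_Suc simp: num_bool_def)
  show "effective (\<lambda>x. F x = G x)"
    by (rule effective_nat_op[OF assms, of "\<lambda>m n. (m - n) + (n - m)"])
      (auto intro: computable_arith simp: num_bool_def)
qed

lemma effective_Suc [effective_intros]: "effective F \<Longrightarrow> effective (\<lambda>x. Suc (F x))"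
  using effective_nat_arith(1)[of F "\<lambda>x. 1", OF _ effective_const] by simp

lemma effective_if [effective_intros]:
  fixes F :: "'a::numbered \<Rightarrow> 'b::numbered"
  assumes "effective P" and "effective F" and "effective G"
  shows "effective (\<lambda>x. if P x then F x else G x)"
proof -
  obtain p f g where p: "computable p" "\<And>n. P (num n) = num (p n)"
    and f: "computable f" "\<And>n. F (num n) = num (f n)" and g: "computable g" "\<And>n. G (num n) = num (g n)"
    using assms unfolding effective_def by metis
  have eq: "(if P (num n) then F (num n) else G (num n)) =
      num ((1 - p n) * f n + (1 - (1 - p n)) * g n)" for n
    by (cases "p n = 0") (simp_all add: p f g num_bool_def)
  have "computable (\<lambda>n. (1 - p n) * f n + (1 - (1 - p n)) * g n)"
    by (intro computable_arith computable_const p f g)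
  then show ?thesis unfolding effective_def using eq by blast
qed

lemma effective_bool [effective_intros]:
  assumes "effective P" and "effective Q"
  shows "effective (\<lambda>x. P x \<and> Q x)" and "effective (\<lambda>x. P x \<or> Q x)"
proof -
  have "(\<lambda>x. P x \<and> Q x) = (\<lambda>x. if P x then Q x else False)"
    and "(\<lambda>x. P x \<or> Q x) = (\<lambda>x. if P x then True else Q x)" by auto
  then show "effective (\<lambda>x. P x \<and> Q x)" and "effective (\<lambda>x. P x \<or> Q x)"
    by (simp_all only: effective_if assms effective_const)
qed

lemma effective_not [effective_intros]:
  assumes "effective P"
  shows "effective (\<lambda>x. \<not> P x)"
proof -
  have "(\<lambda>x. \<not> P x) = (\<lambda>x. if P x then False else True)" by auto
  then show ?thesis by (simp only: effective_if assms effective_const)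
qed

lemma effective_rat_of_triple [effective_intros]:
  assumes "effective F"
  shows "effective (\<lambda>x. rat_of_triple (F x))"
proof -
  have "effective rat_of_triple"
    unfolding effective_def num_rat_def num_nat_def
    by (intro exI[of _ "\<lambda>n. n"] conjI computable_ident) simp
  from effective_comp[OF this assms] show ?thesis .
qed

lemma rat_of_triple_ops:
  defines "w \<equiv> \<lambda>s t. snd (snd s) * snd (snd t) + snd (snd s) + snd (snd t)"
  shows "rat_of_triple s + rat_of_triple t = rat_of_triple
      (fst s * Suc (snd (snd t)) + fst t * Suc (snd (snd s)),
       fst (snd s) * Suc (snd (snd t)) + fst (snd t) * Suc (snd (snd s)), w s t)"
    and "rat_of_triple s * rat_of_triple t = rat_of_triple
      (fst s * fst t + fst (snd s) * fst (snd t), fst s * fst (snd t) + fst (snd s) * fst t, w s t)"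
    and "rat_of_triple s \<le> rat_of_triple t \<longleftrightarrow>
      fst s * Suc (snd (snd t)) + fst (snd t) * Suc (snd (snd s)) \<le>
      fst t * Suc (snd (snd s)) + fst (snd s) * Suc (snd (snd t))"
proof -
  obtain a b c where s: "s = (a, b, c)" by (metis prod.exhaust)
  obtain a' b' c' where t: "t = (a', b', c')" by (metis prod.exhaust)
  have pos: "(of_nat (Suc c) :: rat) > 0" "(of_nat (Suc c') :: rat) > 0" by (simp_all del: of_nat_Suc)
  have w: "(of_nat (Suc (w s t)) :: rat) = of_nat (Suc c) * of_nat (Suc c')"
    unfolding w_def s t of_nat_mult[symmetric] by (simp add: algebra_simps)
  show "rat_of_triple s + rat_of_triple t = rat_of_triple
      (fst s * Suc (snd (snd t)) + fst t * Suc (snd (snd s)),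
       fst (snd s) * Suc (snd (snd t)) + fst (snd t) * Suc (snd (snd s)), w s t)"
    unfolding rat_of_triple_def fst_conv snd_conv w
    using pos by (simp add: s t field_simps del: of_nat_Suc mult_Suc mult_Suc_right)
  show "rat_of_triple s * rat_of_triple t = rat_of_triple
      (fst s * fst t + fst (snd s) * fst (snd t), fst s * fst (snd t) + fst (snd s) * fst t, w s t)"
    unfolding rat_of_triple_def fst_conv snd_conv w
    using pos by (simp add: s t field_simps del: of_nat_Suc mult_Suc mult_Suc_right)
  have "rat_of_triple s \<le> rat_of_triple t \<longleftrightarrow>
      (of_nat (fst s * Suc (snd (snd t)) + fst (snd t) * Suc (snd (snd s))) :: rat) \<le>
      of_nat (fst t * Suc (snd (snd s)) + fst (snd s) * Suc (snd (snd t)))"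
    unfolding rat_of_triple_def
    using pos by (simp add: s t field_simps del: of_nat_Suc mult_Suc mult_Suc_right)
  then show "rat_of_triple s \<le> rat_of_triple t \<longleftrightarrow>
      fst s * Suc (snd (snd t)) + fst (snd t) * Suc (snd (snd s)) \<le>
      fst t * Suc (snd (snd s)) + fst (snd s) * Suc (snd (snd t))"
    by (simp only: of_nat_le_iff)
qed

text \<open>
  An operation on rationals needs to be computed only on representing triples: a pair of rationals
  is decoded by decoding a pair of triples.
\<close>

lemma effective_rat_op:
  assumes op: "effective (\<lambda>p. H (rat_of_triple (fst p)) (rat_of_triple (snd p)))"
    and "effective F" and "effective G"
  shows "effective (\<lambda>x. H (F x) (G x))"
proof -
  obtain h where h: "computable h"
    "\<And>n. (\<lambda>p. H (rat_of_triple (fst p)) (rat_of_triple (snd p))) (num n) = num (h n)"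
    using op unfolding effective_def by blast
  then have "effective (\<lambda>p. H (fst p) (snd p))"
    unfolding effective_def by (auto simp: num_prod_def num_rat_def)
  from effective_comp[OF this effective_Pair[OF assms(2,3)]] show ?thesis by simp
qed

lemma effective_rat_arith [effective_intros]:
  fixes F G :: "'a::numbered \<Rightarrow> rat"
  assumes "effective F" and "effective G"
  shows "effective (\<lambda>x. F x + G x)" and "effective (\<lambda>x. F x * G x)"
    and "effective (\<lambda>x. F x \<le> G x)"
  by (rule effective_rat_op[OF _ assms]; unfold rat_of_triple_ops; intro effective_intros)+

lemma effective_rat_diff_less [effective_intros]:
  fixes F G :: "'a::numbered \<Rightarrow> rat"
  assumes "effective F" and "effective G"
  shows "effective (\<lambda>x. F x - G x)" and "effective (\<lambda>x. F x < G x)"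
proof -
  have "effective (\<lambda>x. F x + (- 1) * G x)" and "effective (\<lambda>x. \<not> G x \<le> F x)"
    by (intro effective_intros assms)+
  then show "effective (\<lambda>x. F x - G x)" and "effective (\<lambda>x. F x < G x)"
    by (simp_all add: not_le)
qed

lemma effective_abs [effective_intros]:
  fixes F :: "'a::numbered \<Rightarrow> rat"
  assumes "effective F"
  shows "effective (\<lambda>x. \<bar>F x\<bar>)"
proof -
  have "effective (\<lambda>x. if F x < 0 then 0 - F x else F x)"
    by (intro effective_intros assms)
  moreover have "\<bar>F x\<bar> = (if F x < 0 then 0 - F x else F x)" for x by simp
  ultimately show ?thesis by (simp only:)
qed

lemma effective_rat_of_nat [effective_intros]:
  fixes F :: "'a::numbered \<Rightarrow> nat"
  assumes "effective F"
  shows "effective (\<lambda>x. of_nat (F x) :: rat)"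
proof -
  have "effective (\<lambda>x. rat_of_triple (F x, 0, 0))"
    by (intro effective_intros assms)
  then show ?thesis by (simp add: rat_of_triple_def)
qed

lemma effective_rat_power [effective_intros]:
  fixes F :: "'a::numbered \<Rightarrow> rat"
  assumes "effective F" and "effective N"
  shows "effective (\<lambda>x. F x ^ N x)"
proof -
  have "effective (\<lambda>x. rec_nat 1 (\<lambda>k r. F x * r) (N x))"
    by (intro effective_intros assms(2) effective_comp[OF assms(1)])
  moreover have "rec_nat 1 (\<lambda>k r. q * r) n = q ^ n" for q :: rat and n by (induction n) auto
  ultimately show ?thesis by simp
qed

lemma effective_sum:
  fixes F :: "'a::numbered \<Rightarrow> nat \<Rightarrow> rat"
  assumes "effective (\<lambda>p. F (fst p) (snd p))" and "effective N"
  shows "effective (\<lambda>x. \<Sum>k<N x. F x k)"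
proof -
  have "effective (\<lambda>p. F (fst p) (fst (snd p)))"
    using effective_comp[OF assms(1), of "\<lambda>p. (fst p, fst (snd p))"]
    by (simp add: effective_intros)
  then have "effective (\<lambda>x. rec_nat 0 (\<lambda>k r. r + F x k) (N x))"
    by (intro effective_intros assms(2))
  moreover have "rec_nat 0 (\<lambda>k r. r + f k) n = (\<Sum>k<n. f k)" for f :: "nat \<Rightarrow> rat" and n
    by (induction n) (auto simp: algebra_simps)
  ultimately show ?thesis by simp
qed

lemma effective_nat_sum:
  fixes F :: "'a::numbered \<Rightarrow> nat \<Rightarrow> nat"
  assumes "effective (\<lambda>p. F (fst p) (snd p))" and "effective N"
  shows "effective (\<lambda>x. \<Sum>k<N x. F x k)"
proof -
  have "effective (\<lambda>p. F (fst p) (fst (snd p)))"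
    using effective_comp[OF assms(1), of "\<lambda>p. (fst p, fst (snd p))"]
    by (simp add: effective_intros)
  then have "effective (\<lambda>x. rec_nat 0 (\<lambda>k r. r + F x k) (N x))"
    by (intro effective_intros assms(2))
  moreover have "rec_nat 0 (\<lambda>k r. r + f k) n = (\<Sum>k<n. f k)" for f :: "nat \<Rightarrow> nat" and n
    by (induction n) (auto simp: algebra_simps)
  ultimately show ?thesis by simp
qed

lemma effective_rat_seq_iff: "effective q \<longleftrightarrow> computable_rat_seq q"
proof
  assume "effective q"
  then obtain f where f: "computable f" "\<And>n. q n = rat_of_triple (num (f n))"
    unfolding effective_def num_rat_def num_nat_def by blast
  let ?s = "\<lambda>n. snd (prod_decode (f n))"
  have "computable (\<lambda>n. fst (prod_decode (f n)))" "computable (\<lambda>n. fst (prod_decode (?s n)))"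
    "computable (\<lambda>n. snd (prod_decode (?s n)))"
    by (intro computable_comp[OF computable_prod_decode(1)] computable_comp[OF computable_prod_decode(2)] f(1))+
  then show "computable_rat_seq q"
    unfolding computable_rat_seq_def f(2) rat_of_triple_def num_prod_def num_nat_def fst_conv snd_conv
    by blast
next
  assume "computable_rat_seq q"
  then obtain a b c where abc: "computable a" "computable b" "computable c"
    "q = (\<lambda>k. rat_of_triple (a k, b k, c k))"
    unfolding computable_rat_seq_def rat_of_triple_def fst_conv snd_conv by (metis ext)
  then have "effective a" "effective b" "effective c" by (simp_all add: effective_nat_iff)
  then show "effective q" unfolding abc(4) by (intro effective_intros)
qed

lemma computable2_if_effective:
  assumes "effective (\<lambda>p. f (fst p) (snd p))"
  shows "computable2 f"
proof -
  obtain g where g: "computable g" "\<And>n. (\<lambda>p. f (fst p) (snd p)) (num n) = g n"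
    using assms unfolding effective_def num_nat_def by blast
  have "list_computable 2 (\<lambda>xs. g (prod_encode (xs ! 0, xs ! 1)))"
    by (intro list_computable_apply[OF g(1)] list_computable_pair list_computable_nth) simp_all
  moreover have "g (prod_encode (n, k)) = f n k" for n k
    using g(2)[of "prod_encode (n, k)"] by (simp add: num_prod_def num_nat_def)
  ultimately show ?thesis by (simp add: computable2_iff_list)
qed

lemma computable_rat_seq2_if_effective:
  assumes "effective (\<lambda>p. q (fst p) (snd p))"
  shows "computable_rat_seq2 q"
proof -
  obtain f where f: "computable f" "\<And>n. (\<lambda>p. q (fst p) (snd p)) (num n) = rat_of_triple (num (f n))"
    using assms unfolding effective_def num_rat_def by blast
  have q: "q n k = rat_of_triple (num (f (prod_encode (n, k))))" for n k
    using f(2)[of "prod_encode (n, k)"] by (simp add: num_prod_def num_nat_def)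
  have f': "effective (\<lambda>p. f (prod_encode p))"
    unfolding effective_def by (intro exI[of _ f]) (simp add: f(1) num_prod_def num_nat_def)
  have tr: "effective (num :: nat \<Rightarrow> nat \<times> nat \<times> nat)"
    unfolding effective_def num_nat_def by (intro exI[of _ "\<lambda>n. n"]) (simp add: computable_ident)
  let ?t = "\<lambda>n k. num (f (prod_encode (n, k))) :: nat \<times> nat \<times> nat"
  have T: "effective (\<lambda>p. ?t (fst p) (snd p))"
    using effective_comp[OF tr f'] by simp
  have t: "effective (\<lambda>p. fst (?t (fst p) (snd p)))" "effective (\<lambda>p. fst (snd (?t (fst p) (snd p))))"
    "effective (\<lambda>p. snd (snd (?t (fst p) (snd p))))"
    by (intro effective_intros T)+
  have "computable2 (\<lambda>n k. fst (?t n k))" "computable2 (\<lambda>n k. fst (snd (?t n k)))"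
    "computable2 (\<lambda>n k. snd (snd (?t n k)))"
    by (rule computable2_if_effective, rule t)+
  then show ?thesis unfolding computable_rat_seq2_def q rat_of_triple_def by blast
qed

section \<open>Names and the range of the characteristic dyadic value\<close>

lemma sum_name_terms_le:
  assumes "is_name f x" and "finite S"
  shows "(\<Sum>k\<in>S. (1 / 2) ^ f k) \<le> x"
  using assms sum_le_suminf[of "\<lambda>k. (1 / 2 :: real) ^ f k" S]
  by (auto simp: is_name_def sums_iff)

lemma name_eventually_ge:
  assumes "is_name f x"
  obtains K where "\<And>k. K \<le> k \<Longrightarrow> N \<le> f k"
proof -
  have "(\<lambda>k. (1 / 2 :: real) ^ f k) \<longlonglongrightarrow> 0"
    using assms summable_LIMSEQ_zero by (auto simp: is_name_def sums_iff)
  then have "eventually (\<lambda>k. (1 / 2 :: real) ^ f k < (1 / 2) ^ N) sequentially"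
    by (rule order_tendstoD) simp
  then obtain K where "\<And>k. K \<le> k \<Longrightarrow> (1 / 2 :: real) ^ f k < (1 / 2) ^ N"
    by (auto simp: eventually_sequentially)
  then have "\<And>k. K \<le> k \<Longrightarrow> N \<le> f k"
    by (simp add: power_strict_decreasing_iff less_imp_le)
  then show thesis by (rule that)
qed

lemma finite_fibre:
  assumes "is_name f x"
  shows "finite {k. f k = n}"
proof -
  obtain K where "\<And>k. K \<le> k \<Longrightarrow> Suc n \<le> f k" using name_eventually_ge[OF assms] by blast
  then have "{k. f k = n} \<subseteq> {..<K}" by (metis (mono_tags, lifting) Suc_n_not_le_n lessThan_iff mem_Collect_eq not_le subsetI)
  then show ?thesis by (rule finite_subset) simp
qed

lemma fibre_count_mult_le:
  assumes "is_name f x"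
  shows "real (fibre_count f n) * (1 / 2) ^ n \<le> x"
  using sum_name_terms_le[OF assms finite_fibre[OF assms, of n]] by (simp add: fibre_count_def)

text \<open>
  Regrouping a finite part of a name by exponents can only add the terms of the touched fibres that
  were missing. All tail estimates for names rest on this.
\<close>

lemma sum_le_sum_fibres:
  assumes "is_name f x" and "finite S" and "\<And>j. 0 \<le> w j"
  shows "(\<Sum>k\<in>S. w (f k)) \<le> (\<Sum>j\<in>f ` S. real (fibre_count f j) * w j)"
proof -
  have "(\<Sum>k\<in>S. w (f k)) = (\<Sum>j\<in>f ` S. \<Sum>k | k \<in> S \<and> f k = j. w (f k))"
    using assms(2) by (intro sum.group[symmetric]) auto
  also have "\<dots> = (\<Sum>j\<in>f ` S. real (card {k. k \<in> S \<and> f k = j}) * w j)"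
    by (intro sum.cong) auto
  also have "\<dots> \<le> (\<Sum>j\<in>f ` S. real (fibre_count f j) * w j)"
    unfolding fibre_count_def
    by (intro sum_mono mult_right_mono assms(3) of_nat_mono card_mono finite_fibre[OF assms(1)]) auto
  finally show ?thesis .
qed

text \<open>
  If all roots were eventually below \<open>1\<close>, the fibres would eventually be empty; but a name takes
  arbitrarily large values.
\<close>

lemma limsup_root_fibre_count_ge_1:
  assumes "is_name f x"
  shows "1 \<le> limsup (\<lambda>n. ereal (root n (real (fibre_count f n))))"
proof (rule ccontr)
  assume "\<not> ?thesis"
  then have "eventually (\<lambda>n. ereal (root n (real (fibre_count f n))) < 1) sequentially"
    by (intro Limsup_lessD) simp
  then obtain n0 where n0: "\<And>n. n0 \<le> n \<Longrightarrow> root n (real (fibre_count f n)) < 1"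
    by (auto simp: eventually_sequentially one_ereal_def)
  obtain K where "\<And>k. K \<le> k \<Longrightarrow> Suc n0 \<le> f k" using name_eventually_ge[OF assms] by blast
  then have K: "Suc n0 \<le> f K" by simp
  have "0 < fibre_count f (f K)"
    using finite_fibre[OF assms, of "f K"] by (auto simp: fibre_count_def card_gt_0_iff)
  then have "1 \<le> root (f K) (real (fibre_count f (f K)))"
    using K by (intro real_root_ge_1_iff[THEN iffD2]) auto
  then show False using n0[of "f K"] K by simp
qed

lemma char_dyadic_value_ge_1: "1 \<le> char_dyadic_value x"
  unfolding char_dyadic_value_def by (rule Inf_greatest) (auto intro: limsup_root_fibre_count_ge_1)

text \<open>The linear factor is harmless because the \<open>n\<close>-th roots of \<open>C\<close> and of \<open>n\<close> tend to \<open>1\<close>.\<close>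

lemma char_dyadic_value_le:
  assumes "computable f" and "is_name f x" and "0 < C" and "0 < r"
    and u: "\<And>n. 1 \<le> n \<Longrightarrow> real (fibre_count f n) \<le> C * real n * r ^ n"
  shows "char_dyadic_value x \<le> ereal r"
proof -
  have "(\<lambda>n. root n C * root n (real n) * r) \<longlonglongrightarrow> 1 * 1 * r"
    by (intro tendsto_intros LIMSEQ_root_const LIMSEQ_root assms)
  then have lim: "(\<lambda>n. ereal (root n C * root n (real n) * r)) \<longlonglongrightarrow> ereal r" by simp
  have "root n (real (fibre_count f n)) \<le> root n C * root n (real n) * r" if "1 \<le> n" for n
  proof -
    have "root n (real (fibre_count f n)) \<le> root n (C * real n * r ^ n)"
      using u that by (intro real_root_le_mono) auto
    also have "\<dots> = root n C * root n (real n) * r"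
      using that assms(4) by (simp add: real_root_mult real_root_power_cancel)
    finally show ?thesis .
  qed
  then have "eventually (\<lambda>n. ereal (root n (real (fibre_count f n))) \<le>
      ereal (root n C * root n (real n) * r)) sequentially"
    by (auto simp: eventually_sequentially)
  from Limsup_mono[OF this]
  have "limsup (\<lambda>n. ereal (root n (real (fibre_count f n)))) \<le> ereal r"
    using lim_imp_Limsup[OF _ lim] by simp
  moreover have "char_dyadic_value x \<le> limsup (\<lambda>n. ereal (root n (real (fibre_count f n))))"
    unfolding char_dyadic_value_def by (rule Inf_lower) (use assms(1,2) in blast)
  ultimately show ?thesis by (rule order_trans[rotated])
qed

section \<open>Greedy names\<close>

text \<open>
  The alternative \<open>p \<le> s\<close> only makes the search total; the greedy sum always stays below its bound.
\<close>

definition greedy_exponent :: "rat \<Rightarrow> rat \<Rightarrow> nat" where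
  "greedy_exponent s p = (LEAST e. s + (1 / 2) ^ e < p \<or> p \<le> s)"

definition greedy_sum :: "(nat \<Rightarrow> rat) \<Rightarrow> nat \<Rightarrow> rat" where
  "greedy_sum q = rec_nat 0 (\<lambda>k s. s + (1 / 2) ^ greedy_exponent s (q k))"

definition greedy_name :: "(nat \<Rightarrow> rat) \<Rightarrow> nat \<Rightarrow> nat" where
  "greedy_name q n = greedy_exponent (greedy_sum q n) (q n)"

lemma greedy_sum_rec:
  "greedy_sum q 0 = 0"
  "greedy_sum q (Suc n) = greedy_sum q n + (1 / 2) ^ greedy_name q n"
  by (simp_all add: greedy_sum_def greedy_name_def)

lemma greedy_sum_eq: "real_of_rat (greedy_sum q n) = (\<Sum>k<n. (1 / 2) ^ greedy_name q k)"
  by (induction n) (simp_all add: greedy_sum_rec of_rat_add of_rat_power of_rat_divide)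

lemma ex_half_power_below:
  fixes s p :: rat
  shows "\<exists>e. s + (1 / 2) ^ e < p \<or> p \<le> s"
proof (cases "p \<le> s")
  case False
  then have "0 < real_of_rat (p - s)" by simp
  then obtain e where "(1 / 2 :: real) ^ e < real_of_rat (p - s)"
    using real_arch_pow_inv[of "real_of_rat (p - s)" "1 / 2"] by auto
  also have "(1 / 2 :: real) ^ e = real_of_rat ((1 / 2) ^ e)"
    by (simp add: of_rat_power of_rat_divide)
  finally have "(1 / 2) ^ e < p - s" by (simp only: of_rat_less)
  then show ?thesis by (intro exI[of _ e]) simp
qed simp

lemma greedy_exponent_upper:
  assumes "s < p"
  shows "s + (1 / 2) ^ greedy_exponent s p < p"
  using LeastI_ex[OF ex_half_power_below[of s p]] assms by (auto simp: greedy_exponent_def)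

text \<open>
  Unless the exponent is \<open>0\<close>, a power twice as large would not fit, so the step at least halves the
  gap.
\<close>

lemma greedy_exponent_lower:
  assumes "greedy_exponent s p \<noteq> 0"
  shows "p \<le> s + 2 * (1 / 2) ^ greedy_exponent s p"
proof -
  obtain e where e: "greedy_exponent s p = Suc e" using assms by (cases "greedy_exponent s p") auto
  then have "\<not> (s + (1 / 2) ^ e < p \<or> p \<le> s)"
    using not_less_Least[of e "\<lambda>e. s + (1 / 2) ^ e < p \<or> p \<le> s"] by (auto simp: greedy_exponent_def)
  then show ?thesis using e by simp
qed

lemma effective_greedy_name:
  assumes "effective q"
  shows "effective (greedy_name q)"
proof -
  have ge: "effective (\<lambda>p. greedy_exponent (fst p) (snd p))"
    unfolding greedy_exponent_def
    by (intro effective_Least effective_intros ex_half_power_below)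
  have step: "effective (\<lambda>p :: nat \<times> nat \<times> rat. greedy_exponent (snd (snd p)) (q (fst (snd p))))"
    using effective_comp[OF ge, of "\<lambda>p. (snd (snd p), q (fst (snd p)))"]
    by (simp add: effective_intros effective_comp[OF assms])
  have "effective (\<lambda>n. greedy_sum q n)"
    unfolding greedy_sum_def by (intro effective_intros step)
  then show ?thesis
    unfolding greedy_name_def[abs_def]
    using effective_comp[OF ge, of "\<lambda>n. (greedy_sum q n, q n)"] assms
    by (simp add: effective_intros)
qed

lemma greedy_sum_less:
  assumes "mono q" and "0 < q 0"
  shows "greedy_sum q n + (1 / 2) ^ greedy_name q n < q n"
proof (induction n)
  case 0
  show ?case unfolding greedy_name_def by (rule greedy_exponent_upper) (simp add: assms(2) greedy_sum_rec)
next
  case (Suc n)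
  then have "greedy_sum q (Suc n) < q n" by (simp add: greedy_sum_rec)
  also have "q n \<le> q (Suc n)" using assms(1) by (simp add: mono_def)
  finally show ?case unfolding greedy_name_def by (rule greedy_exponent_upper)
qed

context
  fixes q :: "nat \<Rightarrow> rat" and x :: real
  assumes mono: "mono q" and pos: "0 < q 0" and lim: "(\<lambda>n. real_of_rat (q n)) \<longlonglongrightarrow> x"
begin

lemma approx_le: "real_of_rat (q n) \<le> x"
proof (rule incseq_le[OF _ lim])
  show "incseq (\<lambda>n. real_of_rat (q n))"
    using mono by (simp add: incseq_def mono_def of_rat_less_eq)
qed

text \<open>
  The emitted powers tend to \<open>0\<close> because their sum is bounded, and the gap to \<open>q n\<close> is eventually at most twice
  the next power. So the greedy sums are squeezed to the limit of \<open>q\<close>.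
\<close>

lemma is_name_greedy_name: "is_name (greedy_name q) x"
proof -
  let ?a = "\<lambda>k. (1 / 2 :: real) ^ greedy_name q k"
  have upper: "(\<Sum>k<n. ?a k) \<le> real_of_rat (q n)" for n
  proof -
    have "greedy_sum q n < greedy_sum q n + (1 / 2) ^ greedy_name q n" by simp
    also have "\<dots> < q n" by (rule greedy_sum_less[OF mono pos])
    finally show ?thesis unfolding greedy_sum_eq[symmetric] by (simp add: of_rat_less_eq)
  qed
  have "summable ?a"
    using order_trans[OF upper approx_le] by (intro summableI_nonneg_bounded[of _ x]) auto
  then have zero: "?a \<longlonglongrightarrow> 0" by (rule summable_LIMSEQ_zero)
  have "eventually (\<lambda>n. ?a n < 1) sequentially"
    using zero by (rule order_tendstoD) simp
  then have "eventually (\<lambda>n. real_of_rat (q n) - 2 * ?a n \<le> (\<Sum>k<n. ?a k)) sequentially"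
  proof eventually_elim
    case (elim n)
    then have "greedy_name q n \<noteq> 0" by (intro notI) simp
    then have "q n \<le> greedy_sum q n + 2 * (1 / 2) ^ greedy_name q n"
      unfolding greedy_name_def by (rule greedy_exponent_lower)
    then have "real_of_rat (q n) \<le> real_of_rat (greedy_sum q n + 2 * (1 / 2) ^ greedy_name q n)"
      by (simp only: of_rat_less_eq)
    then show ?case
      by (simp add: of_rat_add of_rat_mult of_rat_power of_rat_divide greedy_sum_eq)
  qed
  moreover have L: "(\<lambda>n. real_of_rat (q n) - 2 * ?a n) \<longlonglongrightarrow> x"
    using tendsto_diff[OF lim tendsto_mult_right_zero[OF zero, of 2]] by simp
  ultimately have "(\<lambda>n. \<Sum>k<n. ?a k) \<longlonglongrightarrow> x"
    using tendsto_sandwich[OF _ eventuallyI[OF upper] _ lim] by simp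
  then show ?thesis by (simp add: is_name_def sums_def)
qed

text \<open>
  At most \<open>m + 1\<close> of the indices are \<open>\<le> m\<close>. When \<open>m\<close> is emitted at a later index \<open>n\<close>, the gap to
  \<open>q n\<close> is at most \<open>2 * (1/2) ^ m\<close> and \<open>q n\<close> itself misses \<open>x\<close> by at most \<open>(1/2) ^ n \<le> (1/2) ^ m\<close>, so
  that only three powers \<open>(1/2) ^ m\<close> fit below \<open>x\<close> from there on.
\<close>

lemma fibre_count_greedy_name_le:
  assumes fast: "\<And>n. x - real_of_rat (q n) \<le> (1 / 2) ^ n" and "m \<noteq> 0"
  shows "fibre_count (greedy_name q) m \<le> m + 4"
proof -
  let ?f = "greedy_name q"
  define B where "B = {k. ?f k = m} \<inter> {m<..}"
  have fin: "finite {k. ?f k = m}" by (rule finite_fibre[OF is_name_greedy_name])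
  then have finB: "finite B" by (simp add: B_def)
  have "card B \<le> 3"
  proof (cases "B = {}")
    case False
    define n where "n = Min B"
    have n: "?f n = m" "m < n" using Min_in[OF finB False] by (auto simp: n_def B_def)
    have "B \<inter> {..<n} = {}" using Min_le[OF finB] by (fastforce simp: n_def)
    then have "(\<Sum>k\<in>B. (1 / 2 :: real) ^ ?f k) + (\<Sum>k<n. (1 / 2) ^ ?f k) =
        (\<Sum>k\<in>B \<union> {..<n}. (1 / 2) ^ ?f k)"
      using finB by (simp add: sum.union_disjoint)
    also have "\<dots> \<le> x" using finB by (intro sum_name_terms_le[OF is_name_greedy_name]) simp
    also have "(\<Sum>k\<in>B. (1 / 2 :: real) ^ ?f k) = real (card B) * (1 / 2) ^ m"
      by (simp add: B_def)
    finally have "real (card B) * (1 / 2) ^ m \<le> x - real_of_rat (greedy_sum q n)"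
      by (simp add: greedy_sum_eq)
    also have "q n \<le> greedy_sum q n + 2 * (1 / 2) ^ ?f n"
      unfolding greedy_name_def by (rule greedy_exponent_lower) (use n assms in \<open>simp add: greedy_name_def\<close>)
    then have "real_of_rat (q n) \<le> real_of_rat (greedy_sum q n + 2 * (1 / 2) ^ m)"
      unfolding n by (simp only: of_rat_less_eq)
    then have "x - real_of_rat (greedy_sum q n) \<le> 2 * (1 / 2) ^ m + (x - real_of_rat (q n))"
      by (simp add: of_rat_add of_rat_mult of_rat_power of_rat_divide)
    also have "x - real_of_rat (q n) \<le> (1 / 2) ^ n" by (rule fast)
    also have "(1 / 2 :: real) ^ n \<le> (1 / 2) ^ m" using n by (intro power_decreasing) auto
    finally have "real (card B) * (1 / 2) ^ m \<le> 3 * (1 / 2) ^ m" by simp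
    then show ?thesis by simp
  qed simp
  moreover have "card ({k. ?f k = m} \<inter> {..m}) \<le> card {..m}" by (intro card_mono) auto
  moreover have "{k. ?f k = m} = B \<union> ({k. ?f k = m} \<inter> {..m})" by (auto simp: B_def)
  then have "fibre_count ?f m \<le> card B + card ({k. ?f k = m} \<inter> {..m})"
    unfolding fibre_count_def by (metis card_Un_le)
  ultimately show ?thesis by simp
qed

end

text \<open>The hypotheses amount to \<open>x\<close> being a positive computable real.\<close>

lemma char_dyadic_value_le_1_if_fast_approx:
  assumes "effective q" and "mono q" and "0 < q 0" and "(\<lambda>n. real_of_rat (q n)) \<longlonglongrightarrow> x"
    and "\<And>n. x - real_of_rat (q n) \<le> (1 / 2) ^ n"
  shows "char_dyadic_value x \<le> 1"
proof -
  have "char_dyadic_value x \<le> ereal 1"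
  proof (rule char_dyadic_value_le)
    show "computable (greedy_name q)"
      using effective_greedy_name[OF assms(1)] by (simp add: effective_nat_iff)
    show "is_name (greedy_name q) x" by (rule is_name_greedy_name[OF assms(2-4)])
    show "real (fibre_count (greedy_name q) n) \<le> 5 * real n * 1 ^ n" if "1 \<le> n" for n
      using fibre_count_greedy_name_le[OF assms(2-5), of n] that by simp
  qed simp_all
  then show ?thesis by (simp add: one_ereal_def)
qed

lemma char_dyadic_value_le_2:
  assumes "0 < x" and "left_computable x"
  shows "char_dyadic_value x \<le> 2"
proof -
  obtain q where q: "computable_rat_seq q" "strict_mono q" "(\<lambda>n. real_of_rat (q n)) \<longlonglongrightarrow> x"
    using assms(2) by (auto simp: left_computable_def)
  have "eventually (\<lambda>n. 0 < real_of_rat (q n)) sequentially"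
    using q(3) assms(1) by (rule order_tendstoD)
  then obtain N where N: "0 < q N" by (auto simp: eventually_sequentially)
  let ?q = "\<lambda>n. q (n + N)"
  have eff: "effective ?q"
    using q(1) effective_comp[of q "\<lambda>n. n + N"] by (simp add: effective_rat_seq_iff effective_intros)
  have "mono ?q" using q(2) by (simp add: mono_def strict_mono_less_eq)
  moreover have "(\<lambda>n. real_of_rat (?q n)) \<longlonglongrightarrow> x" using q(3) by (rule LIMSEQ_ignore_initial_segment)
  ultimately have name: "is_name (greedy_name ?q) x" using N by (intro is_name_greedy_name) auto
  have "char_dyadic_value x \<le> ereal 2"
  proof (rule char_dyadic_value_le)
    show "computable (greedy_name ?q)"
      using effective_greedy_name[OF eff] by (simp add: effective_nat_iff)
    show "is_name (greedy_name ?q) x" by (rule name)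
    show "real (fibre_count (greedy_name ?q) n) \<le> x * real n * 2 ^ n" if "1 \<le> n" for n
    proof -
      have "real (fibre_count (greedy_name ?q) n) \<le> x * 2 ^ n"
        using fibre_count_mult_le[OF name, of n] by (simp add: field_simps)
      also have "x * 2 ^ n \<le> x * 2 ^ n * real n"
        using mult_left_mono[of 1 "real n" "x * 2 ^ n"] that assms(1) by simp
      finally show ?thesis by (simp add: algebra_simps)
    qed
  qed (use assms in simp_all)
  then show ?thesis by simp
qed

section \<open>Values below 2 and reordered computability\<close>

text \<open>
  A modulus of the form \<open>c * n + d\<close> is computable whatever the real number \<open>\<rho>\<close> is. The bound \<open>n0\<close>
  makes it respect estimates that hold only from \<open>n0\<close> on.
\<close>

lemma geometric_modulus:
  fixes \<rho> :: real
  assumes "0 < \<rho>" and "\<rho> < 1"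
  shows "\<exists>c d. n0 \<le> d \<and> (\<forall>n. \<forall>k\<ge>c * n + d. \<rho> ^ k / (1 - \<rho>) \<le> (1 / 2) ^ n)"
proof -
  obtain c where c: "\<rho> ^ c < 1 / 2" using real_arch_pow_inv[of "1 / 2" \<rho>] assms by auto
  obtain d where d: "\<rho> ^ d < 1 - \<rho>" using real_arch_pow_inv[of "1 - \<rho>" \<rho>] assms by auto
  have "\<rho> ^ k / (1 - \<rho>) \<le> (1 / 2) ^ n" if "c * n + (d + n0) \<le> k" for n k
  proof -
    have "\<rho> ^ k \<le> \<rho> ^ (c * n + d)" using that assms by (intro power_decreasing) auto
    also have "\<dots> = (\<rho> ^ c) ^ n * \<rho> ^ d" by (simp add: power_add power_mult)
    also have "\<dots> \<le> (1 / 2) ^ n * (1 - \<rho>)"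
      using c d assms by (intro mult_mono power_mono) auto
    finally show ?thesis using assms by (simp add: field_simps)
  qed
  then show ?thesis by (intro exI[of _ c] exI[of _ "d + n0"]) simp
qed

text \<open>
  Choose a name whose limes superior is below some \<open>r < 2\<close>; then \<open>fibre_count f n \<le> r ^ n\<close> for large
  \<open>n\<close>, and \<open>\<rho> = r / 2\<close> works.
\<close>

lemma name_with_geometric_fibres:
  assumes "char_dyadic_value x < 2"
  shows "\<exists>f \<rho> n0. computable f \<and> is_name f x \<and> 0 < \<rho> \<and> \<rho> < 1 \<and>
    (\<forall>n\<ge>n0. real (fibre_count f n) * (1 / 2) ^ n \<le> \<rho> ^ n)"
proof -
  obtain f where f: "computable f" "is_name f x"
    and "limsup (\<lambda>n. ereal (root n (real (fibre_count f n)))) < 2"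
    using assms unfolding char_dyadic_value_def Inf_less_iff by auto
  then obtain r where r: "limsup (\<lambda>n. ereal (root n (real (fibre_count f n)))) < ereal r" "ereal r < 2"
    using ereal_dense2 by blast
  from Limsup_lessD[OF r(1)] obtain n0 where n0: "\<And>n. n0 \<le> n \<Longrightarrow> root n (real (fibre_count f n)) < r"
    by (auto simp: eventually_sequentially)
  have "0 \<le> root n0 (real (fibre_count f n0))" by (simp add: real_root_ge_zero)
  also have "\<dots> < r" by (rule n0) simp
  finally have "0 < r" .
  have "real (fibre_count f n) * (1 / 2) ^ n \<le> (r / 2) ^ n" if "Suc n0 \<le> n" for n
  proof -
    have "real (fibre_count f n) = root n (real (fibre_count f n)) ^ n"
      using that by (simp add: real_root_pow_pos2)
    also have "\<dots> \<le> r ^ n" using n0[of n] that by (intro power_mono) (auto simp: real_root_ge_zero)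
    finally show ?thesis by (simp add: power_divide field_simps)
  qed
  moreover have "r / 2 < 1" using r(2) by simp
  ultimately show ?thesis
    using f \<open>0 < r\<close> by (intro exI[of _ f] exI[of _ "r / 2"] exI[of _ "Suc n0"]) simp
qed

lemma reordered_computable_if_char_dyadic_value_less_2:
  assumes "char_dyadic_value x < 2"
  shows "reordered_computable x"
proof -
  obtain f \<rho> n0 where f: "computable f" "is_name f x" and \<rho>: "0 < \<rho>" "\<rho> < 1"
    and le: "\<And>n. n0 \<le> n \<Longrightarrow> real (fibre_count f n) * (1 / 2) ^ n \<le> \<rho> ^ n"
    using name_with_geometric_fibres[OF assms] by blast
  obtain c d where d: "n0 \<le> d" and mod: "\<And>n k. c * n + d \<le> k \<Longrightarrow> \<rho> ^ k / (1 - \<rho>) \<le> (1 / 2) ^ n"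
    using geometric_modulus[OF \<rho>] by blast
  let ?a = "\<lambda>k. real (fibre_count f k) * (1 / 2) ^ k"
  have sum: "summable ?a"
    using le \<rho> by (intro summable_comparison_test'[OF summable_geometric[of \<rho>], of n0]) auto
  have tail: "\<bar>suminf ?a - (\<Sum>k<K. ?a k)\<bar> \<le> \<rho> ^ K / (1 - \<rho>)" if "n0 \<le> K" for K
  proof -
    have "suminf ?a - (\<Sum>k<K. ?a k) = (\<Sum>k. ?a (k + K))"
      using suminf_split_initial_segment[OF sum, of K] by simp
    moreover have "0 \<le> (\<Sum>k. ?a (k + K))"
      using sum by (intro suminf_nonneg) (auto simp: summable_iff_shift[of ?a])
    moreover have "(\<Sum>k. ?a (k + K)) \<le> (\<Sum>k. \<rho> ^ k * \<rho> ^ K)"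
    proof (rule suminf_le)
      show "?a (k + K) \<le> \<rho> ^ k * \<rho> ^ K" for k
        using le[of "k + K"] that by (simp add: power_add)
      show "summable (\<lambda>k. ?a (k + K))" using sum summable_iff_shift[of ?a] by blast
      show "summable (\<lambda>k. \<rho> ^ k * \<rho> ^ K)"
        using \<rho> by (intro summable_mult2 summable_geometric) simp
    qed
    moreover have "(\<Sum>k. \<rho> ^ k * \<rho> ^ K) = \<rho> ^ K / (1 - \<rho>)"
      using \<rho> by (simp add: suminf_mult2[symmetric] suminf_geometric summable_geometric)
    ultimately show ?thesis by simp
  qed
  have "converges_computably_to (\<lambda>n. \<Sum>k<n. ?a k) (suminf ?a)"
    unfolding converges_computably_to_def
  proof (intro conjI exI[of _ "\<lambda>n. c * n + d"] allI impI)
    show "(\<lambda>n. \<Sum>k<n. ?a k) \<longlonglongrightarrow> suminf ?a" using sum by (rule summable_LIMSEQ)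
    have "effective (\<lambda>n. c * n + d)" by (intro effective_intros)
    then show "computable (\<lambda>n. c * n + d)" by (simp add: effective_nat_iff)
    show "\<bar>suminf ?a - (\<Sum>k<K. ?a k)\<bar> \<le> (1 / 2) ^ n" if "c * n + d \<le> K" for n K
      using tail[of K] mod[OF that] d that by simp
  qed
  then show ?thesis
    using f unfolding reordered_computable_def series_converges_computably_def by blast
qed

section \<open>Regular numbers\<close>

text \<open>
  A relaxed form of names with bounded fibres: only the indices in the decidable set \<open>D\<close> count. This
  tolerates repetitions in the enumeration of a c.e. set as well as finite sets, and it makes sums
  easy to form; whether \<open>D\<close> is infinite matters only at the very end.
\<close>

definition bounded_dyadic_sum :: "real \<Rightarrow> bool" where
  "bounded_dyadic_sum x \<longleftrightarrow> (\<exists>(D :: nat set) g K. effective (\<lambda>k. k \<in> D) \<and> effective g \<and>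
     ((\<lambda>k. (1 / 2) ^ g k) has_sum x) D \<and> (\<forall>m. card {k \<in> D. g k = m} \<le> K))"

lemma bounded_dyadic_sum_0: "bounded_dyadic_sum 0"
  unfolding bounded_dyadic_sum_def
  by (intro exI[of _ "{}"] exI[of _ "\<lambda>k. 0 :: nat"] exI[of _ 0] conjI)
    (simp_all add: effective_const)

text \<open>The two index sets are placed side by side with the pairing function, tagged by 0 and 1.\<close>

lemma bounded_dyadic_sum_add:
  assumes "bounded_dyadic_sum x" and "bounded_dyadic_sum y"
  shows "bounded_dyadic_sum (x + y)"
proof -
  obtain D1 :: "nat set" and g1 K1 where 1: "effective (\<lambda>k. k \<in> D1)" "effective g1"
      "((\<lambda>k. (1 / 2) ^ g1 k) has_sum x) D1" "\<And>m. card {k \<in> D1. g1 k = m} \<le> K1"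
    using assms(1) unfolding bounded_dyadic_sum_def by blast
  obtain D2 :: "nat set" and g2 K2 where 2: "effective (\<lambda>k. k \<in> D2)" "effective g2"
      "((\<lambda>k. (1 / 2) ^ g2 k) has_sum y) D2" "\<And>m. card {k \<in> D2. g2 k = m} \<le> K2"
    using assms(2) unfolding bounded_dyadic_sum_def by blast
  define e where "e = (\<lambda>i k. prod_encode (i :: nat, k))"
  define g where "g p = (if fst (prod_decode p) = 0 then g1 (snd (prod_decode p)) else g2 (snd (prod_decode p)))" for p
  let ?D = "e 0 ` D1 \<union> e 1 ` D2"
  have inj: "inj_on (e i) A" for i A by (auto simp: e_def inj_on_def)
  have g: "g (e 0 k) = g1 k" "g (e 1 k) = g2 k" for k by (simp_all add: g_def e_def)
  have D: "p \<in> ?D \<longleftrightarrow> fst (prod_decode p) = 0 \<and> snd (prod_decode p) \<in> D1 \<or>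
      fst (prod_decode p) = 1 \<and> snd (prod_decode p) \<in> D2" for p
  proof -
    obtain i k where "p = prod_encode (i, k)" by (metis prod_decode_inverse surj_pair)
    then show ?thesis by (auto simp: e_def)
  qed
  have dec: "effective (\<lambda>p. fst (prod_decode p))" "effective (\<lambda>p. snd (prod_decode p))"
    by (simp_all add: effective_nat_iff computable_prod_decode)
  have "effective (\<lambda>p. p \<in> ?D)"
    unfolding D by (intro effective_intros dec effective_comp[OF 1(1)] effective_comp[OF 2(1)])
  moreover have "effective g"
    unfolding g_def[abs_def]
    by (intro effective_intros dec effective_comp[OF 1(2)] effective_comp[OF 2(2)])
  moreover have "((\<lambda>p. (1 / 2) ^ g p) has_sum (x + y)) ?D"
  proof (rule has_sum_Un_disjoint)
    show "((\<lambda>p. (1 / 2) ^ g p) has_sum x) (e 0 ` D1)" "((\<lambda>p. (1 / 2) ^ g p) has_sum y) (e 1 ` D2)"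
      using 1(3) 2(3) by (simp_all add: has_sum_reindex inj o_def g g[unfolded One_nat_def])
    show "e 0 ` D1 \<inter> e 1 ` D2 = {}" by (auto simp: e_def)
  qed
  moreover have "card {p \<in> ?D. g p = m} \<le> K1 + K2" for m
  proof -
    have "{p \<in> ?D. g p = m} = e 0 ` {k \<in> D1. g1 k = m} \<union> e 1 ` {k \<in> D2. g2 k = m}"
      using g by auto
    then have "card {p \<in> ?D. g p = m} \<le> card (e 0 ` {k \<in> D1. g1 k = m}) + card (e 1 ` {k \<in> D2. g2 k = m})"
      by (simp add: card_Un_le)
    also have "\<dots> = card {k \<in> D1. g1 k = m} + card {k \<in> D2. g2 k = m}"
      by (simp add: card_image inj)
    also have "\<dots> \<le> K1 + K2" using 1(4) 2(4) by (intro add_mono)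
    finally show ?thesis .
  qed
  ultimately show ?thesis unfolding bounded_dyadic_sum_def by blast
qed

text \<open>
  Keeping only first occurrences in the enumeration \<open>h\<close> of the c.e. set makes it injective; being a
  first occurrence is decidable although membership in the set need not be.
\<close>

lemma bounded_dyadic_sum_strongly_left_computable:
  assumes "strongly_left_computable y"
  shows "bounded_dyadic_sum y"
proof -
  obtain A where A: "ce_set A" "((\<lambda>n. (1 / 2) ^ (n + 1)) has_sum y) A"
    using assms by (auto simp: strongly_left_computable_def)
  show ?thesis
  proof (cases "A = {}")
    case True
    then have "y = 0" using A(2) by (metis has_sum_empty has_sum_unique)
    then show ?thesis by (simp add: bounded_dyadic_sum_0)
  next
    case False
    then obtain h where h: "computable h" "A = range h" using A(1) by (auto simp: ce_set_def)
    define D where "D = {k. \<forall>j<k. h j \<noteq> h k}"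
    have eh: "effective h" using h(1) by (simp add: effective_nat_iff)
    have inj: "inj_on h D"
      by (rule inj_onI) (metis (mono_tags, lifting) D_def linorder_neqE_nat mem_Collect_eq)
    have "h ` D = A"
    proof (intro equalityI subsetI)
      fix a assume "a \<in> A"
      then obtain k where "h k = a" using h(2) by auto
      then have "h (LEAST k. h k = a) = a" by (rule LeastI)
      moreover from this have "(LEAST k. h k = a) \<in> D"
        unfolding D_def using not_less_Least by auto
      ultimately show "a \<in> h ` D" by (metis imageI)
    qed (use h(2) in auto)
    then have bij: "bij_betw h D A" using inj by (simp add: bij_betw_def)
    have eq: "k \<in> D \<longleftrightarrow> (\<Sum>j<k. if h j = h k then 1 else 0 :: nat) = 0" for k
      by (auto simp: D_def)
    have "effective (\<lambda>k. \<Sum>j<k. if h j = h k then 1 else 0 :: nat)"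
      by (intro effective_nat_sum effective_intros effective_comp[OF eh])
    then have "effective (\<lambda>k. k \<in> D)" unfolding eq by (intro effective_intros)
    moreover have "effective (\<lambda>k. h k + 1)" by (intro effective_intros eh)
    moreover have "((\<lambda>k. (1 / 2) ^ (h k + 1)) has_sum y) D"
      using has_sum_reindex_bij_betw[OF bij, of "\<lambda>n. (1 / 2 :: real) ^ (n + 1)" y] A(2) by simp
    moreover have "card {k \<in> D. h k + 1 = m} \<le> 1" for m
    proof -
      have "inj_on h {k \<in> D. h k + 1 = m}" using inj by (rule inj_on_subset) auto
      moreover have "h ` {k \<in> D. h k + 1 = m} \<subseteq> {m - 1}" by auto
      ultimately have "card {k \<in> D. h k + 1 = m} \<le> card {m - 1}" by (rule card_inj_on_le) simp
      then show ?thesis by simp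
    qed
    ultimately show ?thesis unfolding bounded_dyadic_sum_def by blast
  qed
qed

lemma bounded_dyadic_sum_if_regular:
  assumes "regular_real x"
  shows "bounded_dyadic_sum x"
proof -
  obtain ys where ys: "\<forall>y\<in>set ys. strongly_left_computable y" "x = sum_list ys"
    using assms by (auto simp: regular_real_def)
  have "bounded_dyadic_sum (sum_list ys)" using ys(1)
    by (induction ys)
      (simp_all add: bounded_dyadic_sum_0 bounded_dyadic_sum_add bounded_dyadic_sum_strongly_left_computable)
  then show ?thesis by (simp add: ys(2))
qed

lemma effective_enumerate:
  fixes D :: "nat set"
  assumes "effective (\<lambda>k. k \<in> D)" and "infinite D"
  shows "effective (enumerate D)"
proof -
  have ex: "\<exists>k. k \<in> D \<and> r < k" for r
    using assms(2) unfolding infinite_nat_iff_unbounded by blast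
  let ?L = "\<lambda>r. LEAST k. k \<in> D \<and> r < k"
  have L: "effective ?L"
    by (intro effective_Least effective_intros effective_comp[OF assms(1)] ex)
  have "effective (\<lambda>n. rec_nat (LEAST k. k \<in> D) (\<lambda>_. ?L) n)"
    by (intro effective_intros effective_comp[OF L])
  moreover have "rec_nat (LEAST k. k \<in> D) (\<lambda>_. ?L) n = enumerate D n" for n
    by (induction n) (simp_all add: enumerate_0 enumerate_Suc''[OF assms(2)])
  ultimately show ?thesis by simp
qed

lemma char_dyadic_value_rat_le_1:
  assumes "0 < r"
  shows "char_dyadic_value (real_of_rat r) \<le> 1"
proof -
  obtain c where c: "real_of_rat r < 2 ^ c" using real_arch_pow[of 2 "real_of_rat r"] by auto
  \<comment> \<open>The shift by \<open>c\<close> makes the approximation fast, the further shift by one makes it positive.\<close>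
  let ?q = "\<lambda>n. r - r * (1 / 2) ^ (n + Suc c)"
  have q: "real_of_rat (?q n) = real_of_rat r - real_of_rat r * (1 / 2) ^ (n + Suc c)" for n
    by (simp add: of_rat_diff of_rat_mult of_rat_power of_rat_divide)
  show ?thesis
  proof (rule char_dyadic_value_le_1_if_fast_approx)
    show "effective ?q" by (intro effective_intros)
    show "mono ?q"
      using assms by (intro monoI diff_left_mono mult_left_mono power_decreasing) auto
    have "(1 / 2 :: rat) ^ Suc c < 1" by (rule power_Suc_less_one) auto
    then show "0 < ?q 0" using assms mult_strict_left_mono[of "(1 / 2) ^ Suc c" 1 r] by simp
    have "(\<lambda>n. (1 / 2 :: real) ^ (n + Suc c)) \<longlonglongrightarrow> 0"
      by (intro LIMSEQ_ignore_initial_segment LIMSEQ_power_zero) simp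
    then show "(\<lambda>n. real_of_rat (?q n)) \<longlonglongrightarrow> real_of_rat r"
      unfolding q using tendsto_diff[OF tendsto_const tendsto_mult_right_zero] by fastforce
    show "real_of_rat r - real_of_rat (?q n) \<le> (1 / 2) ^ n" for n
    proof -
      have "real_of_rat r * (1 / 2) ^ Suc c \<le> 1" 
        using c by (simp add: field_simps) (use c zero_less_power[of "2 :: real" c] in linarith)
      then have "real_of_rat r * (1 / 2) ^ Suc c * (1 / 2) ^ n \<le> 1 * (1 / 2) ^ n"
        by (intro mult_right_mono) auto
      then show ?thesis unfolding q by (simp add: power_add algebra_simps)
    qed
  qed
qed

text \<open>
  An infinite index set is enumerated in increasing order to obtain a genuine name; for a finite one
  \<open>x\<close> is rational.
\<close>

lemma char_dyadic_value_le_1_if_regular: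
  assumes "0 < x" and "regular_real x"
  shows "char_dyadic_value x \<le> 1"
proof -
  obtain D :: "nat set" and g K where D: "effective (\<lambda>k. k \<in> D)" and g: "effective g"
    and sum: "((\<lambda>k. (1 / 2) ^ g k) has_sum x) D" and K: "\<And>m. card {k \<in> D. g k = m} \<le> K"
    using bounded_dyadic_sum_if_regular[OF assms(2)] unfolding bounded_dyadic_sum_def by blast
  show ?thesis
  proof (cases "finite D")
    case True
    then have "x = (\<Sum>k\<in>D. (1 / 2) ^ g k)" using sum by (metis has_sum_finite has_sum_unique)
    also have "\<dots> = real_of_rat (\<Sum>k\<in>D. (1 / 2) ^ g k)"
      by (simp add: of_rat_sum of_rat_power of_rat_divide)
    finally have "x = real_of_rat (\<Sum>k\<in>D. (1 / 2) ^ g k)" .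
    then show ?thesis using assms(1) char_dyadic_value_rat_le_1 by (metis zero_less_of_rat_iff)
  next
    case False
    let ?f = "\<lambda>n. g (enumerate D n)"
    have bij: "bij_betw (enumerate D) UNIV D" using False by (rule bij_enumerate)
    have "((\<lambda>n. (1 / 2) ^ ?f n) has_sum x) UNIV"
      using has_sum_reindex_bij_betw[OF bij, of "\<lambda>k. (1 / 2 :: real) ^ g k" x] sum by simp
    then have name: "is_name ?f x"
      unfolding is_name_def by (rule has_sum_imp_sums)
    have "fibre_count ?f m \<le> K" for m
    proof -
      have "enumerate D ` {n. ?f n = m} = {k \<in> D. g k = m}"
        using bij by (auto simp: bij_betw_def)
      moreover have "inj_on (enumerate D) {n. ?f n = m}"
        using bij by (auto simp: bij_betw_def inj_on_def)
      ultimately show ?thesis unfolding fibre_count_def using K[of m] by (metis card_image)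
    qed
    then have K': "real (fibre_count ?f n) \<le> real K" for n by simp
    have "char_dyadic_value x \<le> ereal 1"
    proof (rule char_dyadic_value_le)
      show "computable ?f"
        using effective_comp[OF g effective_enumerate[OF D False]] by (simp add: effective_nat_iff)
      show "is_name ?f x" by (rule name)
      show "real (fibre_count ?f n) \<le> real (Suc K) * real n * 1 ^ n" if "1 \<le> n" for n
      proof -
        have "K \<le> Suc K * n" using that by (cases n) auto
        then have "real K \<le> real (Suc K) * real n" by (metis of_nat_le_iff of_nat_mult)
        then show ?thesis using K'[of n] by simp
      qed
    qed simp_all
    then show ?thesis by (simp add: one_ereal_def)
  qed
qed

section \<open>Nearly computable numbers\<close>

definition name_sum :: "(nat \<Rightarrow> nat) \<Rightarrow> nat \<Rightarrow> rat" where
  "name_sum f n = (\<Sum>k<n. (1 / 2) ^ f k)"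

lemma of_rat_name_sum: "real_of_rat (name_sum f n) = (\<Sum>k<n. (1 / 2) ^ f k)"
  by (simp add: name_sum_def of_rat_sum of_rat_power of_rat_divide)

lemma effective_name_sum:
  assumes "computable f"
  shows "effective (name_sum f)"
proof -
  have f: "effective f" using assms by (simp add: effective_nat_iff)
  show ?thesis
    unfolding name_sum_def[abs_def] by (intro effective_sum effective_intros effective_comp[OF f])
qed

lemma mono_name_sum: "mono (name_sum f)"
  unfolding name_sum_def by (intro monoI sum_mono2) auto

lemma name_sum_tendsto: "is_name f x \<Longrightarrow> (\<lambda>n. real_of_rat (name_sum f n)) \<longlonglongrightarrow> x"
  by (simp add: of_rat_name_sum is_name_def sums_def)

lemma name_sum_less:
  assumes "is_name f x"
  shows "real_of_rat (name_sum f n) < x"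
proof -
  have "real_of_rat (name_sum f n) < (\<Sum>k<Suc n. (1 / 2) ^ f k)" by (simp add: of_rat_name_sum)
  also have "\<dots> \<le> x" by (rule sum_name_terms_le[OF assms]) simp
  finally show ?thesis .
qed

text \<open>
  All terms from index \<open>P\<close> on lie in fibres above \<open>N\<close>, and those fibres are dominated by a geometric
  series.
\<close>

lemma name_tail_le:
  assumes name: "is_name f x" and \<rho>: "0 < \<rho>" "\<rho> < 1"
    and le: "\<forall>n\<ge>n0. real (fibre_count f n) * (1 / 2) ^ n \<le> \<rho> ^ n"
    and "n0 \<le> N" and P: "\<And>k. P \<le> k \<Longrightarrow> N \<le> f k"
  shows "x - real_of_rat (name_sum f P) \<le> \<rho> ^ N / (1 - \<rho>)"
proof -
  have "real_of_rat (name_sum f M) - real_of_rat (name_sum f P) \<le> \<rho> ^ N / (1 - \<rho>)" if "P \<le> M" for M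
  proof -
    let ?J = "f ` {P..<M}"
    have J: "N \<le> j" if "j \<in> ?J" for j using that P by auto
    have "real_of_rat (name_sum f M) - real_of_rat (name_sum f P) = (\<Sum>k\<in>{P..<M}. (1 / 2) ^ f k)"
      using sum_diff_nat_ivl[of 0 P M "\<lambda>k. (1 / 2 :: real) ^ f k"] that
      by (simp add: of_rat_name_sum atLeast0LessThan)
    also have "\<dots> \<le> (\<Sum>j\<in>?J. real (fibre_count f j) * (1 / 2) ^ j)"
      by (rule sum_le_sum_fibres[OF name]) auto
    also have "\<dots> \<le> (\<Sum>j\<in>?J. \<rho> ^ j)" using le J \<open>n0 \<le> N\<close> 
      by (intro sum_mono) (meson order_trans)
    also have "\<dots> = (\<Sum>j\<in>?J. \<rho> ^ N * \<rho> ^ (j - N))"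
      using J by (intro sum.cong) (auto simp: power_add[symmetric])
    also have "\<dots> = \<rho> ^ N * (\<Sum>i\<in>(\<lambda>j. j - N) ` ?J. \<rho> ^ i)"
    proof -
      have "inj_on (\<lambda>j. j - N) ?J" using J by (intro inj_on_diff_nat) auto
      then show ?thesis by (simp add: sum.reindex sum_distrib_left)
    qed
    also have "\<dots> \<le> \<rho> ^ N * (\<Sum>i. \<rho> ^ i)"
      using \<rho> by (intro mult_left_mono sum_le_suminf summable_geometric) auto
    also have "\<dots> = \<rho> ^ N / (1 - \<rho>)" using \<rho> by (simp add: suminf_geometric)
    finally show ?thesis .
  qed
  then show ?thesis
    using tendsto_diff[OF name_sum_tendsto[OF name] tendsto_const]
    by (intro LIMSEQ_le_const2[of "\<lambda>M. real_of_rat (name_sum f M) - real_of_rat (name_sum f P)"]) auto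
qed

lemma strict_mono_straddle:
  fixes s :: "nat \<Rightarrow> nat"
  assumes "strict_mono s" and "s k0 \<le> j"
  shows "\<exists>k\<ge>k0. s k \<le> j \<and> j < s (Suc k)"
  using assms(2)
proof (induction j rule: dec_induct)
  case base
  then show ?case using assms(1) by (intro exI[of _ k0]) (simp add: strict_mono_less)
next
  case (step j)
  then obtain k where k: "k0 \<le> k" "s k \<le> j" "j < s (Suc k)" by blast
  show ?case
  proof (cases "Suc j < s (Suc k)")
    case True
    then show ?thesis using k by (intro exI[of _ k]) simp
  next
    case False
    then have "s (Suc k) = Suc j" using k by simp
    moreover have "s (Suc k) < s (Suc (Suc k))" using assms(1) by (simp add: strict_mono_less)
    ultimately show ?thesis using k by (intro exI[of _ "Suc k"]) simp
  qed
qed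

text \<open>
  The subsequence \<open>s\<close> is chosen such that \<open>q\<close> and the partial sums \<open>X\<close> of the name nearly agree on it.
  Near computability bounds the increments of \<open>q\<close> along \<open>s\<close>, hence those of \<open>X\<close>, from a computable
  index on. As \<open>X\<close> is increasing, the increment over a block bounds each single term in the block;
  and the bound holds for all later blocks at once, so no small exponent can reappear.
\<close>

lemma name_escape_modulus:
  assumes f: "computable f" "is_name f x" and "nearly_computable x"
  shows "\<exists>p. effective p \<and> (\<forall>N. \<forall>j\<ge>p N. N \<le> f j)"
proof -
  obtain q where q: "computable_rat_seq q" "(\<lambda>n. real_of_rat (q n)) \<longlonglongrightarrow> x"
    and nc: "\<And>s. computable s \<Longrightarrow> strict_mono s \<Longrightarrow>
      converges_computably_to (\<lambda>n. real_of_rat (q (s (n + 1))) - real_of_rat (q (s n))) 0"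
    using assms(3) unfolding nearly_computable_def nearly_computably_convergent_def by blast
  let ?X = "name_sum f"
  have eff: "effective q" "effective ?X" using q(1) f(1) effective_name_sum
    by (simp_all add: effective_rat_seq_iff)
  have ex: "\<exists>m'. m < m' \<and> \<bar>q m' - ?X m'\<bar> \<le> (1 / 2) ^ Suc n" for m n
  proof -
    have "(\<lambda>i. real_of_rat (q i) - real_of_rat (?X i)) \<longlonglongrightarrow> x - x"
      by (intro tendsto_diff q(2) name_sum_tendsto[OF f(2)])
    then have "(\<lambda>i. \<bar>real_of_rat (q i) - real_of_rat (?X i)\<bar>) \<longlonglongrightarrow> 0"
      by (simp add: tendsto_rabs_zero_iff)
    then have "eventually (\<lambda>i. \<bar>real_of_rat (q i) - real_of_rat (?X i)\<bar> < (1 / 2) ^ Suc n) sequentially"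
      by (rule order_tendstoD) simp
    then obtain I where I: "\<And>i. I \<le> i \<Longrightarrow> \<bar>real_of_rat (q i) - real_of_rat (?X i)\<bar> < (1 / 2) ^ Suc n"
      by (auto simp: eventually_sequentially)
    let ?i = "max I (Suc m)"
    have "real_of_rat \<bar>q ?i - ?X ?i\<bar> < real_of_rat ((1 / 2) ^ Suc n)"
      using I[of ?i] unfolding abs_of_rat[symmetric] of_rat_diff
      by (simp add: of_rat_power of_rat_divide of_rat_mult)
    then have "\<bar>q ?i - ?X ?i\<bar> < (1 / 2) ^ Suc n" by (simp only: of_rat_less)
    then show ?thesis by (intro exI[of _ ?i]) auto
  qed
  define next_index where
    "next_index = (\<lambda>n m. LEAST m'. m < m' \<and> \<bar>q m' - ?X m'\<bar> \<le> (1 / 2) ^ Suc n)"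
  define s where "s = rec_nat 0 next_index"
  have nextI: "m < next_index n m \<and> \<bar>q (next_index n m) - ?X (next_index n m)\<bar> \<le> (1 / 2) ^ Suc n" for n m
    unfolding next_index_def by (rule LeastI_ex) (rule ex)
  have sm: "strict_mono s" using nextI by (intro strict_monoI_Suc) (simp add: s_def)
  have close: "\<bar>real_of_rat (q (s (Suc n))) - real_of_rat (?X (s (Suc n)))\<bar> \<le> (1 / 2) ^ Suc n" for n
  proof -
    have "\<bar>q (s (Suc n)) - ?X (s (Suc n))\<bar> \<le> (1 / 2) ^ Suc n" using nextI by (simp add: s_def)
    then have "real_of_rat \<bar>q (s (Suc n)) - ?X (s (Suc n))\<bar> \<le> real_of_rat ((1 / 2) ^ Suc n)"
      by (simp only: of_rat_less_eq)
    then show ?thesis unfolding abs_of_rat[symmetric] of_rat_diff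
      by (simp add: of_rat_power of_rat_divide of_rat_mult)
  qed
  have "effective (\<lambda>p. next_index (fst p) (snd p))"
    unfolding next_index_def
    by (rule effective_Least) (intro effective_intros effective_comp[OF eff(1)] effective_comp[OF eff(2)] ex)+
  then have next_eff: "effective (\<lambda>p :: nat \<times> nat \<times> nat. next_index (fst (snd p)) (snd (snd p)))"
    using effective_comp[of "\<lambda>p. next_index (fst p) (snd p)" "\<lambda>p. (fst (snd p), snd (snd p))"]
    by (simp add: effective_intros)
  have es: "effective s" unfolding s_def by (rule effective_rec[of "\<lambda>n. 0" "\<lambda>n. next_index" "\<lambda>n. n"])
      (simp_all add: effective_intros next_eff)
  then have "converges_computably_to (\<lambda>n. real_of_rat (q (s (n + 1))) - real_of_rat (q (s n))) 0"
    by (intro nc sm) (simp add: effective_nat_iff)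
  then obtain h where h: "computable h"
    and "\<forall>N. \<forall>k\<ge>h N. \<bar>0 - (real_of_rat (q (s (k + 1))) - real_of_rat (q (s k)))\<bar> \<le> (1 / 2) ^ N"
    unfolding converges_computably_to_def by blast
  then have h_le: "\<bar>real_of_rat (q (s (Suc k))) - real_of_rat (q (s k))\<bar> \<le> (1 / 2) ^ N"
    if "h N \<le> k" for N k
    using that by (simp add: abs_minus_commute)
  \<comment> \<open>The three errors \<open>(1/2) ^ (N + 2)\<close>, \<open>(1/2) ^ (N + 3)\<close> and \<open>(1/2) ^ (N + 3)\<close> add up to less than \<open>(1/2) ^ N\<close>.\<close>
  define p where "p N = s (h (N + 2) + N + 3)" for N
  have eh: "effective h" using h by (simp add: effective_nat_iff)
  have "effective p"
    unfolding p_def[abs_def] by (intro effective_comp[OF es] effective_intros effective_comp[OF eh])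
  moreover have "N \<le> f j" if pN: "p N \<le> j" for N j
  proof -
    obtain k where k: "h (N + 2) + N + 3 \<le> k" "s k \<le> j" "j < s (Suc k)"
      using strict_mono_straddle[OF sm pN[unfolded p_def]] by blast
    then obtain k' where k': "k = Suc k'" by (cases k) auto
    have "(1 / 2 :: real) ^ f j = real_of_rat (?X (Suc j)) - real_of_rat (?X j)"
      by (simp add: of_rat_name_sum)
    also have "\<dots> \<le> real_of_rat (?X (s (Suc k))) - real_of_rat (?X (s k))"
      using k monoD[OF mono_name_sum[of f], of "Suc j" "s (Suc k)"]
        monoD[OF mono_name_sum[of f], of "s k" j] by (intro diff_mono) (simp_all add: of_rat_less_eq)
    also have "\<dots> \<le> (1 / 2) ^ (N + 2) + (1 / 2) ^ k + (1 / 2) ^ Suc k"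
      using h_le[of "N + 2" k] close[of k] close[of k'] k(1) unfolding k' by linarith
    also have "\<dots> \<le> (1 / 2) ^ (N + 2) + (1 / 2) ^ (N + 3) + (1 / 2) ^ (N + 3)"
      using k(1) by (intro add_mono order.refl power_decreasing) auto
    also have "\<dots> \<le> (1 / 2) ^ N" by (simp add: power_add power3_eq_cube)
    finally show ?thesis by (simp add: power_decreasing_iff)
  qed
  ultimately show ?thesis by blast
qed

text \<open>
  Once it is known where the exponents stay large, the tails of the name are computably small, so
  the partial sums, sampled along a suitable computable sequence, are a fast approximation of \<open>x\<close>.
\<close>

lemma char_dyadic_value_le_1_if_nearly_computable:
  assumes "nearly_computable x" and "char_dyadic_value x < 2"
  shows "char_dyadic_value x \<le> 1"
proof -
  obtain f \<rho> n0 where f: "computable f" "is_name f x" and \<rho>: "0 < \<rho>" "\<rho> < 1"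
    and le: "\<forall>n\<ge>n0. real (fibre_count f n) * (1 / 2) ^ n \<le> \<rho> ^ n"
    using name_with_geometric_fibres[OF assms(2)] by blast
  obtain c d where d: "n0 \<le> d"
    and mod: "\<And>n k. c * n + d \<le> k \<Longrightarrow> \<rho> ^ k / (1 - \<rho>) \<le> (1 / 2) ^ n"
    using geometric_modulus[OF \<rho>] by blast
  obtain p where p: "effective p" "\<And>N j. p N \<le> j \<Longrightarrow> N \<le> f j"
    using name_escape_modulus[OF f assms(1)] by blast
  \<comment> \<open>Summing the moduli makes the sampling indices increasing, and \<open>Suc\<close> makes the first sample positive.\<close>
  define R where "R n = Suc (\<Sum>i<Suc n. p (c * i + d))" for n
  have R: "p (c * n + d) \<le> R n" for n by (simp add: R_def)
  let ?q = "\<lambda>n. name_sum f (R n)"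
  show ?thesis
  proof (rule char_dyadic_value_le_1_if_fast_approx)
    have "effective R"
      unfolding R_def[abs_def] by (intro effective_intros effective_nat_sum effective_comp[OF p(1)])
    then show "effective ?q" by (rule effective_comp[OF effective_name_sum[OF f(1)]])
    have "mono R" unfolding R_def by (intro monoI Suc_le_mono[THEN iffD2] sum_mono2) auto
    then show "mono ?q" using mono_name_sum[of f] by (auto simp: mono_def)
    show "0 < ?q 0" unfolding name_sum_def R_def by (intro sum_pos) auto
    show fast: "x - real_of_rat (?q n) \<le> (1 / 2) ^ n" for n
    proof -
      have "x - real_of_rat (?q n) \<le> \<rho> ^ (c * n + d) / (1 - \<rho>)"
        by (rule name_tail_le[OF f(2) \<rho> le]) (use d p(2)[of "c * n + d"] R[of n] in auto)
      also have "\<dots> \<le> (1 / 2) ^ n" by (rule mod) simp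
      finally show ?thesis .
    qed
    show "(\<lambda>n. real_of_rat (?q n)) \<longlonglongrightarrow> x"
    proof (rule tendsto_sandwich)
      show "(\<lambda>n. x - (1 / 2) ^ n) \<longlonglongrightarrow> x"
        using tendsto_diff[OF tendsto_const LIMSEQ_power_zero[of "1 / 2 :: real"]] by simp
      show "eventually (\<lambda>n. x - (1 / 2) ^ n \<le> real_of_rat (?q n)) sequentially"
        using fast by (auto simp: algebra_simps)
      show "eventually (\<lambda>n. real_of_rat (?q n) \<le> x) sequentially"
        using name_sum_less[OF f(2)] by (intro eventuallyI less_imp_le)
    qed simp
  qed
qed

section \<open>Random numbers\<close>

text \<open>
  Suppose that \<open>X\<close> increases to \<open>x\<close>. From the stage \<open>t\<close> of the last reset on, the open interval above
  \<open>X t\<close> is extended in proportion to the growth of \<open>Y\<close>. As soon as \<open>X\<close> has grown since stage \<open>t\<close> by at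
  least \<open>\<delta>\<close> times the growth of \<open>Y\<close>, the interval is abandoned and a new one is started. The type is
  generic so that the same definition runs on rationals and is analysed over the reals.
\<close>

definition last_reset ::
  "(nat \<Rightarrow> 'a::linordered_field) \<Rightarrow> (nat \<Rightarrow> 'a) \<Rightarrow> 'a \<Rightarrow> nat \<Rightarrow> nat" where
  "last_reset X Y \<delta> = rec_nat 0 (\<lambda>s t. if X t + \<delta> * (Y (Suc s) - Y t) \<le> X (Suc s) then Suc s else t)"

lemma last_reset_rec:
  "last_reset X Y \<delta> 0 = 0"
  "last_reset X Y \<delta> (Suc s) =
     (let t = last_reset X Y \<delta> s in if X t + \<delta> * (Y (Suc s) - Y t) \<le> X (Suc s) then Suc s else t)"
  by (simp_all add: last_reset_def Let_def)

lemma last_reset_of_rat: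
  "last_reset (\<lambda>n. real_of_rat (X n)) (\<lambda>n. real_of_rat (Y n)) (real_of_rat \<delta>) s = last_reset X Y \<delta> s"
proof (induction s)
  case (Suc s)
  have "real_of_rat a + real_of_rat \<delta> * (real_of_rat b - real_of_rat c) \<le> real_of_rat e \<longleftrightarrow>
      a + \<delta> * (b - c) \<le> e" for a b c e
    by (simp only: of_rat_add[symmetric] of_rat_mult[symmetric] of_rat_diff[symmetric] of_rat_less_eq)
  then show ?case using Suc by (simp add: last_reset_rec Let_def)
qed (simp add: last_reset_rec)

text \<open>
  The factor \<open>2\<close> against the \<open>\<delta>\<close> of the reset condition makes room for a strict inequality in the
  limit: an interval that is never abandoned contains \<open>x\<close> and not only has \<open>x\<close> as an endpoint.
\<close>

definition covering_interval :: "(nat \<Rightarrow> real) \<Rightarrow> (nat \<Rightarrow> real) \<Rightarrow> real \<Rightarrow> nat \<Rightarrow> real set" where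
  "covering_interval X Y \<delta> s =
     (let t = last_reset X Y \<delta> s in {X t <..< X t + 2 * \<delta> * (Y s - Y t)})"

lemma last_reset_le: "last_reset X Y \<delta> s \<le> s"
  by (induction s) (auto simp: last_reset_rec Let_def le_Suc_eq)

lemma last_reset_idem: "last_reset X Y \<delta> (last_reset X Y \<delta> s) = last_reset X Y \<delta> s"
  by (induction s) (auto simp: last_reset_rec Let_def)

lemma last_reset_greater:
  assumes "N \<le> s" and "last_reset X Y \<delta> s \<noteq> last_reset X Y \<delta> N"
  shows "N < last_reset X Y \<delta> s"
  using assms
proof (induction s rule: dec_induct)
  case (step s)
  then show ?case by (auto simp: last_reset_rec(2) Let_def split: if_splits)
qed simp

text \<open>
  In each stage the interval is either extended by \<open>2 * \<delta>\<close> times the increment of \<open>Y\<close> or replaced by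
  the empty one, so the total measure telescopes.
\<close>

lemma emeasure_covering_intervals_le:
  assumes "mono Y" and "0 \<le> \<delta>" and "\<And>n. Y n - Y 0 \<le> W"
  shows "emeasure lborel (\<Union>s. covering_interval X Y \<delta> s) \<le> ennreal (2 * \<delta> * W)"
proof -
  let ?J = "covering_interval X Y \<delta>"
  let ?A = "\<lambda>n. \<Union>s\<le>n. ?J s"
  have J: "?J s \<in> sets lborel" for s by (simp add: covering_interval_def Let_def)
  have A: "?A n \<in> sets lborel" for n using J by blast
  have le: "emeasure lborel (?A n) \<le> ennreal (2 * \<delta> * (Y n - Y 0))" for n
  proof (induction n)
    case 0
    then show ?case by (simp add: covering_interval_def last_reset_rec)
  next
    case (Suc n)
    define t where "t = last_reset X Y \<delta> n"
    let ?E = "{X t + 2 * \<delta> * (Y n - Y t) ..< X t + 2 * \<delta> * (Y (Suc n) - Y t)}"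
    have step: "0 \<le> 2 * \<delta> * (Y (Suc n) - Y n)" and pos: "0 \<le> 2 * \<delta> * (Y n - Y 0)"
      using assms(1,2) by (auto simp: mono_def)
    have "?J (Suc n) \<subseteq> ?J n \<union> ?E"
      by (auto simp: covering_interval_def last_reset_rec Let_def t_def)
    then have "?A (Suc n) \<subseteq> ?A n \<union> ?E" by (auto simp: atMost_Suc)
    then have "emeasure lborel (?A (Suc n)) \<le> emeasure lborel (?A n \<union> ?E)"
      using A by (intro emeasure_mono) auto
    also have "\<dots> \<le> emeasure lborel (?A n) + emeasure lborel ?E"
      using A by (intro emeasure_subadditive) auto
    also have "emeasure lborel ?E = ennreal (2 * \<delta> * (Y (Suc n) - Y n))"
      using step by (subst emeasure_lborel_Ico) (auto simp: algebra_simps)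
    also have "emeasure lborel (?A n) + \<dots> \<le> ennreal (2 * \<delta> * (Y n - Y 0)) + \<dots>"
      by (intro add_mono Suc order.refl)
    also have "\<dots> = ennreal (2 * \<delta> * (Y (Suc n) - Y 0))"
      using step pos by (simp add: ennreal_plus[symmetric] algebra_simps del: ennreal_plus)
    finally show ?case .
  qed
  have "emeasure lborel (\<Union>n. ?A n) = (SUP n. emeasure lborel (?A n))"
    using A by (intro SUP_emeasure_incseq[symmetric]) (auto simp: incseq_def intro: order_trans)
  also have "\<dots> \<le> ennreal (2 * \<delta> * W)"
  proof (rule SUP_least)
    fix n
    have "2 * \<delta> * (Y n - Y 0) \<le> 2 * \<delta> * W" using assms by (intro mult_left_mono) auto
    then show "emeasure lborel (?A n) \<le> ennreal (2 * \<delta> * W)"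
      using le[of n] by (meson ennreal_leI order_trans)
  qed
  also have "(\<Union>n. ?A n) = (\<Union>s. ?J s)" by auto
  finally show ?thesis .
qed

text \<open>
  If the resets stop, the last interval catches \<open>x\<close>. If they go on forever, then each reset stage \<open>T\<close>
  satisfies \<open>\<delta> * (y - Y T) \<le> x - X T\<close>, against the assumption that the tails of \<open>Y\<close> eventually
  exceed every multiple of the tails of \<open>X\<close>.
\<close>

lemma covering_intervals_cover:
  assumes mono: "mono X" "mono Y" and lim: "X \<longlonglongrightarrow> x" "Y \<longlonglongrightarrow> y"
    and less: "\<And>n. X n < x" "\<And>n. Y n < y" and "0 < \<delta>"
    and slow: "\<And>C. \<exists>N. \<forall>n\<ge>N. real C * (x - X n) \<le> y - Y n"
  shows "x \<in> (\<Union>s. covering_interval X Y \<delta> s)"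
proof (cases "\<exists>s0. \<forall>s\<ge>s0. last_reset X Y \<delta> s = last_reset X Y \<delta> s0")
  case True
  then obtain s0 where s0: "\<And>s. s0 \<le> s \<Longrightarrow> last_reset X Y \<delta> s = last_reset X Y \<delta> s0" by blast
  define t where "t = last_reset X Y \<delta> s0"
  have "X (Suc s) \<le> X t + \<delta> * (Y (Suc s) - Y t)" if "s0 \<le> s" for s
  proof (rule ccontr)
    assume "\<not> ?thesis"
    then have "last_reset X Y \<delta> (Suc s) = Suc s"
      using s0[OF that] by (simp add: last_reset_rec t_def)
    then show False using s0[of "Suc s"] that last_reset_le[of X Y \<delta> s0] by simp
  qed
  then have "x \<le> X t + \<delta> * (y - Y t)"
    using lim by (intro LIMSEQ_le[OF LIMSEQ_Suc[OF lim(1)]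
      tendsto_add[OF tendsto_const tendsto_mult[OF tendsto_const tendsto_diff[OF LIMSEQ_Suc[OF lim(2)] tendsto_const]]]]) blast
  also have "\<dots> < X t + 2 * \<delta> * (y - Y t)" using less(2)[of t] \<open>0 < \<delta>\<close> by simp
  finally have "x < X t + 2 * \<delta> * (y - Y t)" .
  moreover have "(\<lambda>s. X t + 2 * \<delta> * (Y s - Y t)) \<longlonglongrightarrow> X t + 2 * \<delta> * (y - Y t)"
    by (intro tendsto_intros lim)
  ultimately have "eventually (\<lambda>s. x < X t + 2 * \<delta> * (Y s - Y t)) sequentially"
    by (rule order_tendstoD(1)[rotated])
  then obtain s where "s0 \<le> s" "x < X t + 2 * \<delta> * (Y s - Y t)"
    unfolding eventually_sequentially by (metis linorder_le_cases)
  then have "x \<in> covering_interval X Y \<delta> s"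
    using less(1) s0[of s] by (simp add: covering_interval_def t_def Let_def)
  then show ?thesis by blast
next
  case False
  have unbounded: "\<exists>s\<ge>M. M < last_reset X Y \<delta> s" for M
    using False last_reset_greater by blast
  obtain C :: nat where C: "2 / \<delta> \<le> real C" using real_arch_simple by blast
  obtain N where N: "\<And>n. N \<le> n \<Longrightarrow> real C * (x - X n) \<le> y - Y n" using slow by blast
  obtain s1 where "N < last_reset X Y \<delta> s1" using unbounded by blast
  then obtain T where T: "N < T" "last_reset X Y \<delta> T = T" using last_reset_idem by blast
  have reset: "\<delta> * (Y (last_reset X Y \<delta> s) - Y T) \<le> X (last_reset X Y \<delta> s) - X T" if "T \<le> s" for s
    using that
  proof (induction s rule: dec_induct)
    case base
    then show ?case by (simp add: T)
  next
    case (step s)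
    then show ?case by (auto simp: last_reset_rec(2) Let_def algebra_simps)
  qed
  have "\<delta> * (Y M - Y T) \<le> x - X T" for M
  proof -
    obtain s where s: "max M T < last_reset X Y \<delta> s" using unbounded by blast
    let ?m = "last_reset X Y \<delta> s"
    have "\<delta> * (Y M - Y T) \<le> \<delta> * (Y ?m - Y T)"
      using s mono(2) \<open>0 < \<delta>\<close> by (simp add: mono_def)
    also have "\<dots> \<le> X ?m - X T" using s last_reset_le[of X Y \<delta> s] by (intro reset) simp
    also have "\<dots> \<le> x - X T" using less(1)[of ?m] by simp
    finally show ?thesis .
  qed
  then have "\<delta> * (y - Y T) \<le> x - X T"
    by (intro LIMSEQ_le_const2[OF tendsto_mult[OF tendsto_const tendsto_diff[OF lim(2) tendsto_const]]]) blast
  moreover have "2 * (x - X T) \<le> \<delta> * (y - Y T)"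
  proof -
    have "2 * (x - X T) \<le> \<delta> * (real C * (x - X T))"
      using mult_right_mono[of 2 "\<delta> * real C" "x - X T"] C \<open>0 < \<delta>\<close> less(1)[of T]
      by (simp add: field_simps)
    also have "\<dots> \<le> \<delta> * (y - Y T)" using N[of T] T \<open>0 < \<delta>\<close> by (intro mult_left_mono) auto
    finally show ?thesis .
  qed
  ultimately show ?thesis using less(1)[of T] by simp
qed

text \<open>
  For \<open>\<delta> = (1/2) ^ i / (2 * W)\<close>, where \<open>W\<close> bounds the growth of \<open>Y\<close>, the covering intervals have total
  measure at most \<open>(1/2) ^ i\<close>.
\<close>

lemma not_martin_loef_random_if_slower:
  fixes X Y :: "nat \<Rightarrow> rat"
  assumes eff: "effective X" "effective Y" and mono: "mono X" "mono Y"
    and lim: "(\<lambda>n. real_of_rat (X n)) \<longlonglongrightarrow> x" "(\<lambda>n. real_of_rat (Y n)) \<longlonglongrightarrow> y"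
    and less: "\<And>n. real_of_rat (X n) < x" "\<And>n. real_of_rat (Y n) < y"
    and slow: "\<And>C. \<exists>N. \<forall>n\<ge>N. real C * (x - real_of_rat (X n)) \<le> y - real_of_rat (Y n)"
  shows "\<not> martin_loef_random x"
proof -
  obtain W :: nat where W: "y - real_of_rat (Y 0) \<le> real W" using real_arch_simple by blast
  then have "0 < W" using less(2)[of 0] by (intro gr0I) simp
  define \<delta> where "\<delta> i = (1 / 2 :: rat) ^ i * (1 / (2 * of_nat W))" for i :: nat
  let ?t = "\<lambda>i. last_reset X Y (\<delta> i)"
  let ?X = "\<lambda>n. real_of_rat (X n)" and ?Y = "\<lambda>n. real_of_rat (Y n)" and ?\<delta> = "\<lambda>i. real_of_rat (\<delta> i)"
  define U where "U i = (\<Union>s. covering_interval ?X ?Y (?\<delta> i) s)" for i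
  have \<delta>: "?\<delta> i = (1 / 2) ^ i / (2 * real W)" for i
    by (simp add: \<delta>_def of_rat_mult of_rat_power of_rat_divide)
  then have pos: "0 < ?\<delta> i" for i using \<open>0 < W\<close> by simp
  have mono': "mono ?X" "mono ?Y" using mono by (auto simp: mono_def of_rat_less_eq)
  have eff_t: "effective (\<lambda>p. ?t (fst p) (snd p))"
    unfolding last_reset_def \<delta>_def
    by (intro effective_intros effective_comp[OF eff(1)] effective_comp[OF eff(2)])
  let ?a = "\<lambda>i s. X (?t i s)" and ?b = "\<lambda>i s. X (?t i s) + 2 * \<delta> i * (Y s - Y (?t i s))"
  have ab: "effective (\<lambda>p. ?a (fst p) (snd p))" "effective (\<lambda>p. ?b (fst p) (snd p))"
    unfolding \<delta>_def
    by (intro effective_intros effective_comp[OF eff(1)] effective_comp[OF eff(2)] eff_t[unfolded \<delta>_def])+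
  have "computable_rat_seq2 ?a" "computable_rat_seq2 ?b"
    by (rule computable_rat_seq2_if_effective, rule ab)+
  moreover have "U i = (\<Union>s. {real_of_rat (?a i s) <..< real_of_rat (?b i s)})" for i
    unfolding U_def covering_interval_def last_reset_of_rat Let_def
    by (simp add: of_rat_add of_rat_mult of_rat_diff)
  ultimately have "uniformly_ce_open U" unfolding uniformly_ce_open_def by blast
  moreover have "emeasure lborel (U i) \<le> ennreal ((1 / 2) ^ i)" for i
  proof -
    have "?Y n - ?Y 0 \<le> real W" for n using W less(2)[of n] by simp
    then have "emeasure lborel (U i) \<le> ennreal (2 * ?\<delta> i * real W)"
      unfolding U_def using pos[of i] by (intro emeasure_covering_intervals_le mono') auto
    also have "2 * ?\<delta> i * real W = (1 / 2) ^ i" using \<open>0 < W\<close> by (simp add: \<delta>)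
    finally show ?thesis .
  qed
  moreover have "x \<in> U i" for i
    unfolding U_def by (rule covering_intervals_cover[OF mono' lim less pos slow])
  ultimately show ?thesis unfolding martin_loef_random_def by blast
qed

text \<open>
  The slower sequence weights each term \<open>(1/2) ^ f k\<close> by its exponent. The weights tend to infinity,
  so they beat every constant in the tails; and they grow slowly enough for the weighted fibres to
  stay summable.
\<close>

lemma not_martin_loef_random_if_char_dyadic_value_less_2:
  assumes "char_dyadic_value x < 2"
  shows "\<not> martin_loef_random x"
proof -
  obtain f \<rho> n0 where f: "computable f" "is_name f x" and \<rho>: "0 < \<rho>" "\<rho> < 1"
    and le: "\<forall>n\<ge>n0. real (fibre_count f n) * (1 / 2) ^ n \<le> \<rho> ^ n"
    using name_with_geometric_fibres[OF assms] by blast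
  let ?w = "\<lambda>j. real j * (1 / 2) ^ j"
  let ?u = "\<lambda>j. real (fibre_count f j) * ?w j"
  have "summable (\<lambda>n. real (Suc n) * \<rho> ^ n)"
    using geometric_deriv_sums[of \<rho>] \<rho> by (auto simp: sums_iff)
  then have sum_u: "summable ?u"
  proof (rule summable_comparison_test')
    fix n assume "n0 \<le> n"
    have "?u n = real n * (real (fibre_count f n) * (1 / 2) ^ n)" by simp
    also have "\<dots> \<le> real n * \<rho> ^ n" using le \<open>n0 \<le> n\<close> by (intro mult_left_mono) auto
    also have "\<dots> \<le> real (Suc n) * \<rho> ^ n" using \<rho> by (intro mult_right_mono) auto
    finally show "norm (?u n) \<le> real (Suc n) * \<rho> ^ n" by simp
  qed
  have "(\<Sum>k<n. ?w (f k)) \<le> suminf ?u" for n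
  proof -
    have "(\<Sum>k<n. ?w (f k)) \<le> (\<Sum>j\<in>f ` {..<n}. ?u j)" by (rule sum_le_sum_fibres[OF f(2)]) auto
    also have "\<dots> \<le> suminf ?u" using sum_u by (intro sum_le_suminf) auto
    finally show ?thesis .
  qed
  then have sum_w: "summable (\<lambda>k. ?w (f k))"
    by (intro summableI_nonneg_bounded[of _ "suminf ?u"]) auto
  define Y where "Y n = (\<Sum>k<n. of_nat (f k) * (1 / 2 :: rat) ^ f k)" for n
  let ?X = "name_sum f"
  define y where "y = (\<Sum>k. ?w (f k))"
  have Y: "real_of_rat (Y n) = (\<Sum>k<n. ?w (f k))" for n
    by (simp add: Y_def of_rat_sum of_rat_mult of_rat_power of_rat_divide)
  have sum_x: "summable (\<lambda>k. (1 / 2 :: real) ^ f k)" "(\<Sum>k. (1 / 2 :: real) ^ f k) = x"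
    using f(2) by (auto simp: is_name_def sums_iff)
  have slow: "\<exists>N. \<forall>n\<ge>N. real C * (x - real_of_rat (?X n)) \<le> y - real_of_rat (Y n)" for C
  proof -
    obtain N where N: "\<And>k. N \<le> k \<Longrightarrow> C \<le> f k" using name_eventually_ge[OF f(2)] by blast
    have "real C * (x - real_of_rat (?X n)) \<le> y - real_of_rat (Y n)" if "N \<le> n" for n
    proof -
      have "real C * (x - real_of_rat (?X n)) = real C * (\<Sum>k. (1 / 2) ^ f (k + n))"
        using suminf_split_initial_segment[OF sum_x(1), of n] by (simp add: of_rat_name_sum sum_x)
      also have "\<dots> = (\<Sum>k. real C * (1 / 2) ^ f (k + n))"
        using summable_ignore_initial_segment[OF sum_x(1), of n] by (rule suminf_mult[symmetric])
      also have "\<dots> \<le> (\<Sum>k. ?w (f (k + n)))"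
      proof (rule suminf_le)
        show "real C * (1 / 2) ^ f (k + n) \<le> ?w (f (k + n))" for k
          using N[of "k + n"] that by (intro mult_right_mono) auto
        show "summable (\<lambda>k. real C * (1 / 2) ^ f (k + n))"
          by (rule summable_mult[OF summable_ignore_initial_segment[OF sum_x(1)]])
        show "summable (\<lambda>k. ?w (f (k + n)))" by (rule summable_ignore_initial_segment[OF sum_w])
      qed
      also have "\<dots> = y - real_of_rat (Y n)"
        using suminf_split_initial_segment[OF sum_w, of n] by (simp add: Y y_def)
      finally show ?thesis .
    qed
    then show ?thesis by blast
  qed
  have mono_Y: "mono Y" unfolding Y_def by (intro monoI sum_mono2) auto
  have Y_less: "real_of_rat (Y n) < y" for n
  proof -
    obtain N where N: "\<And>n. N \<le> n \<Longrightarrow> real 1 * (x - real_of_rat (?X n)) \<le> y - real_of_rat (Y n)"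
      using slow by blast
    have "real_of_rat (Y n) \<le> real_of_rat (Y (max n N))"
      using monoD[OF mono_Y, of n "max n N"] by (simp add: of_rat_less_eq)
    then show ?thesis using N[of "max n N"] name_sum_less[OF f(2), of "max n N"] by simp
  qed
  have ef: "effective f" using f(1) by (simp add: effective_nat_iff)
  have "effective Y"
    unfolding Y_def[abs_def] by (intro effective_sum effective_intros effective_comp[OF ef])
  moreover have "(\<lambda>n. real_of_rat (Y n)) \<longlonglongrightarrow> y"
    unfolding Y y_def using sum_w by (rule summable_LIMSEQ)
  ultimately show ?thesis
    using not_martin_loef_random_if_slower[OF effective_name_sum[OF f(1)] _ mono_name_sum mono_Y
        name_sum_tendsto[OF f(2)] _ name_sum_less[OF f(2)] Y_less slow] by blast
qed

section \<open>The values of the characteristic dyadic value\<close>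

theorem proposition28:
  fixes x :: real
  assumes "0 < x" and "left_computable x"
  shows "char_dyadic_value x \<in> {1..2} \<and>
    (1 \<le> char_dyadic_value x \<and> char_dyadic_value x < 2 \<longrightarrow> reordered_computable x) \<and>
    (regular_real x \<longrightarrow> char_dyadic_value x = 1) \<and>
    (nearly_computable x \<longrightarrow> char_dyadic_value x = 1 \<or> char_dyadic_value x = 2) \<and>
    (martin_loef_random x \<longrightarrow> char_dyadic_value x = 2)"
proof -
  have bounds: "1 \<le> char_dyadic_value x" "char_dyadic_value x \<le> 2"
    by (rule char_dyadic_value_ge_1) (rule char_dyadic_value_le_2[OF assms])
  have less: "char_dyadic_value x \<noteq> 2 \<Longrightarrow> char_dyadic_value x < 2" using bounds(2) by simp
  have "regular_real x \<Longrightarrow> char_dyadic_value x = 1"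
    using bounds(1) char_dyadic_value_le_1_if_regular[OF assms(1)] by (simp add: antisym)
  moreover have "nearly_computable x \<Longrightarrow> char_dyadic_value x = 1 \<or> char_dyadic_value x = 2"
    using bounds(1) less char_dyadic_value_le_1_if_nearly_computable antisym by blast
  moreover have "martin_loef_random x \<Longrightarrow> char_dyadic_value x = 2"
    using less not_martin_loef_random_if_char_dyadic_value_less_2 by blast
  ultimately show ?thesis
    using bounds reordered_computable_if_char_dyadic_value_less_2 by auto
qed

end
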